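(* Let $d \ge 1$, let $0<\lambda\le\Lambda$, and let $F$ be uniformly elliptic with constants $\lambda,\Lambda$. There is no continuous function $u : Q_1 \to \mathbb R$ such that all of the following hold: $u$ is a viscosity solution of $u_t - F(D^2 u) = 0$ in $Q_1$; $u$ is real analytic in $(t,x)$ on $Q_1 \setminus \{(0,0)\}$ (at points with $t=0$ this means $u$ coincides near the point with a real-analytic function of $(t,x)$ defined in a full neighborhood); the function $x \mapsto u(0,x)$ is homogeneous of degree two on $B_1$ (i.e. $u(0,ax) = a^2 u(0,x)$ whenever $a>0$ and $x, ax \in B_1$); and $x\mapsto u(0,x)$ is not $C^2$ in any neighborhood of $x=0$.
   Context: $B_1$ is the open unit ball of $\mathbb R^d$ and $Q_1 := (-1,0] \times B_1$. A function $F$ on real symmetric $d\times d$ matrices is uniformly elliptic with constants $0<\lambda\le\Lambda$ if for all symmetric $A,B$ with $B \ge 0$, $\lambda \operatorname{tr} B \le F(A+B) - F(A) \le \Lambda \operatorname{tr} B$. $D^2u$ denotes the spatial Hessian. *)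

theory Defs
  imports "HOL-Analysis.Analysis"
begin

definition Q1 :: "(real \<times> (real^'n)) set" where
  "Q1 = {-1<..0} \<times> ball 0 1"

definition symmetric_mat :: "real^'n^'n \<Rightarrow> bool" where
  "symmetric_mat A \<longleftrightarrow> transpose A = A"

definition psd_mat :: "real^'n^'n \<Rightarrow> bool" where
  "psd_mat B \<longleftrightarrow> (\<forall>\<xi>. \<xi> \<bullet> (B *v \<xi>) \<ge> 0)"

definition uniformly_elliptic :: "real \<Rightarrow> real \<Rightarrow> (real^'n^'n \<Rightarrow> real) \<Rightarrow> bool" where
  "uniformly_elliptic lam Lam F \<longleftrightarrow>
     (\<forall>A B. symmetric_mat A \<and> symmetric_mat B \<and> psd_mat B \<longrightarrow>
        lam * trace B \<le> F (A + B) - F A \<and> F (A + B) - F A \<le> Lam * trace B)"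

definition C2_on :: "(real^'n) set \<Rightarrow> (real^'n \<Rightarrow> real) \<Rightarrow> bool" where
  "C2_on S f \<longleftrightarrow> (\<exists>g h.
     continuous_on S f \<and> (\<forall>i. continuous_on S (g i)) \<and> (\<forall>i j. continuous_on S (h i j)) \<and>
     (\<forall>x\<in>S. \<forall>i. ((\<lambda>s. f (x + s *\<^sub>R axis i 1)) has_real_derivative g i x) (at 0)) \<and>
     (\<forall>x\<in>S. \<forall>i j. ((\<lambda>s. g i (x + s *\<^sub>R axis j 1)) has_real_derivative h i j x) (at 0)))"

definition C12_test :: "(real \<times> (real^'n) \<Rightarrow> real) \<Rightarrow> (real \<times> (real^'n) \<Rightarrow> real)
     \<Rightarrow> ('n \<Rightarrow> 'n \<Rightarrow> real \<times> (real^'n) \<Rightarrow> real) \<Rightarrow> bool" where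
  "C12_test phi phit h \<longleftrightarrow> (\<exists>g.
     continuous_on UNIV phi \<and> continuous_on UNIV phit \<and> (\<forall>i. continuous_on UNIV (g i)) \<and>
     (\<forall>i j. continuous_on UNIV (h i j)) \<and>
     (\<forall>t x. ((\<lambda>s. phi (t + s, x)) has_real_derivative phit (t, x)) (at 0)) \<and>
     (\<forall>t x i. ((\<lambda>s. phi (t, x + s *\<^sub>R axis i 1)) has_real_derivative g i (t, x)) (at 0)) \<and>
     (\<forall>t x i j. ((\<lambda>s. g i (t, x + s *\<^sub>R axis j 1)) has_real_derivative h i j (t, x)) (at 0)))"

definition hess_mat :: "('n \<Rightarrow> 'n \<Rightarrow> real \<times> (real^'n) \<Rightarrow> real) \<Rightarrow> real \<times> (real^'n) \<Rightarrow> real^'n^'n" where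
  "hess_mat h p = (\<chi> i j. h i j p)"

definition viscosity_subsolution ::
  "(real^'n^'n \<Rightarrow> real) \<Rightarrow> (real \<times> (real^'n)) set \<Rightarrow> (real \<times> (real^'n) \<Rightarrow> real) \<Rightarrow> bool" where
  "viscosity_subsolution F Q u \<longleftrightarrow>
     (\<forall>p0\<in>Q. \<forall>phi phit h. C12_test phi phit h \<and>
        (\<exists>r>0. \<forall>q\<in>Q. dist q p0 < r \<longrightarrow> u q - phi q \<le> u p0 - phi p0)
        \<longrightarrow> phit p0 - F (hess_mat h p0) \<le> 0)"

definition viscosity_supersolution ::
  "(real^'n^'n \<Rightarrow> real) \<Rightarrow> (real \<times> (real^'n)) set \<Rightarrow> (real \<times> (real^'n) \<Rightarrow> real) \<Rightarrow> bool" where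
  "viscosity_supersolution F Q u \<longleftrightarrow>
     (\<forall>p0\<in>Q. \<forall>phi phit h. C12_test phi phit h \<and>
        (\<exists>r>0. \<forall>q\<in>Q. dist q p0 < r \<longrightarrow> u q - phi q \<ge> u p0 - phi p0)
        \<longrightarrow> phit p0 - F (hess_mat h p0) \<ge> 0)"

definition viscosity_solution ::
  "(real^'n^'n \<Rightarrow> real) \<Rightarrow> (real \<times> (real^'n)) set \<Rightarrow> (real \<times> (real^'n) \<Rightarrow> real) \<Rightarrow> bool" where
  "viscosity_solution F Q u \<longleftrightarrow>
     continuous_on Q u \<and> viscosity_subsolution F Q u \<and> viscosity_supersolution F Q u"

definition real_analytic_at :: "(real \<times> (real^'n) \<Rightarrow> real) \<Rightarrow> real \<times> (real^'n) \<Rightarrow> bool" where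
  "real_analytic_at g p \<longleftrightarrow> (\<exists>r>0. \<exists>c :: nat \<times> ('n \<Rightarrow> nat) \<Rightarrow> real. \<forall>q. dist q p < r \<longrightarrow>
     ((\<lambda>(k, \<alpha>). c (k, \<alpha>) * (fst q - fst p) ^ k * (\<Prod>i\<in>UNIV. (snd q $ i - snd p $ i) ^ \<alpha> i))
        has_sum g q) UNIV)"

definition real_analytic_on :: "(real \<times> (real^'n) \<Rightarrow> real) \<Rightarrow> (real \<times> (real^'n)) set \<Rightarrow> bool" where
  "real_analytic_on g U \<longleftrightarrow> (\<forall>p\<in>U. real_analytic_at g p)"

end

theory Submission
  imports Defs
begin

text \<open>
  Away from the origin an analytic viscosity solution solves the equation classically. The
  terminal datum determines all Taylor coefficients in \<open>t\<close>: as \<open>F\<close> is Lipschitz, two solutions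
  whose coefficients agree below order \<open>k\<close> have Hessians, and hence time derivatives, differing
  by \<open>O(t\<^sup>k)\<close>, so that their \<open>k\<close>-th coefficients agree as well. Comparing \<open>u\<close> with its
  parabolic rescalings, \<open>u\<close> is parabolically homogeneous of degree two and extends to all
  \<open>t \<le> 0\<close>; its time derivative is invariant under the scaling, so \<open>W(y) = u\<^sub>t(-1, y)\<close> is
  bounded. Differentiating the equation in time shows that \<open>W\<close> satisfies an elliptic equation
  with inward drift \<open>- y / 2\<close> and no zeroth-order term, and a Liouville theorem forces \<open>W\<close> to
  be a constant \<open>c\<close>. Hence \<open>u(t, x) = u(0, x) + c t\<close>, so \<open>u(0, \<cdot>)\<close> is analytic at the origin
  and, being homogeneous of degree two, a quadratic form.
\<close>

subsection \<open>Power series\<close>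

lemma nonpos_if_eventually_le_abs:
  fixes c C :: real
  assumes "F \<noteq> bot" "F \<le> at 0" "\<forall>\<^sub>F s in F. c \<le> C * \<bar>s\<bar>"
  shows "c \<le> 0"
proof -
  have "((\<lambda>s. C * \<bar>s\<bar>) \<longlongrightarrow> C * \<bar>0\<bar>) (at 0)" by (intro tendsto_intros)
  from tendsto_lowerbound[OF tendsto_mono[OF assms(2) this] assms(3,1)] show ?thesis by simp
qed

lemma eventually_norm_less: "0 < r \<Longrightarrow> \<forall>\<^sub>F x in nhds (0 :: 'a::real_normed_vector). norm x < r"
  by (auto simp: eventually_nhds_metric dist_norm)

lemma eventually_along_ray:
  fixes x :: "'a::real_normed_vector"
  assumes "\<forall>\<^sub>F z in nhds 0. P z"
  shows "\<forall>\<^sub>F s in nhds 0. P (s *\<^sub>R x)"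
proof -
  have "((\<lambda>s. s *\<^sub>R x) \<longlongrightarrow> 0 *\<^sub>R x) (nhds 0)" by (intro tendsto_intros filterlim_ident)
  from eventually_compose_filterlim[OF _ this[simplified], of P] show ?thesis using assms .
qed

lemma eventually_nhds_imp_at_right: "eventually P (nhds a) \<Longrightarrow> eventually P (at_right a)"
  for a :: "'a::linorder_topology"
  by (rule filter_leD[OF at_within_le_nhds])

lemma powser_tail_sums_zero:
  fixes f :: "nat \<Rightarrow> 'a::real_normed_field"
  assumes "(\<lambda>k. f k * s ^ k) sums 0" "s \<noteq> 0" "\<And>k. k < n \<Longrightarrow> f k = 0"
  shows "(\<lambda>k. f (k + n) * s ^ k) sums 0"
proof -
  have "(\<lambda>k. f (k + n) * s ^ (k + n)) sums (0 - (\<Sum>k<n. f k * s ^ k))"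
    by (rule sums_split_initial_segment[OF assms(1)])
  then have "(\<lambda>k. s ^ n * (f (k + n) * s ^ k)) sums 0"
    using assms(3) by (simp add: power_add mult_ac)
  from sums_mult_D[OF this] assms(2) show ?thesis by simp
qed

lemma powser_coeffs_zero:
  fixes f :: "nat \<Rightarrow> 'a::{real_normed_field, banach}"
  assumes "F \<noteq> bot" "F \<le> at 0" and sums_zero: "\<forall>\<^sub>F s in F. (\<lambda>k. f k * s ^ k) sums 0"
  shows "f n = 0"
proof (induction n rule: less_induct)
  case (less n)
  have "\<forall>\<^sub>F s in F. s \<noteq> 0"
    using assms(2) by (rule filter_leD) (simp add: eventually_at_filter)
  with sums_zero have tail: "\<forall>\<^sub>F s in F. s \<noteq> 0 \<and> (\<lambda>k. f (k + n) * s ^ k) sums 0"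
    by eventually_elim (simp add: powser_tail_sums_zero less.IH)
  then obtain r where r_nonzero: "r \<noteq> 0" and summable: "summable (\<lambda>k. f (k + n) * r ^ k)"
    using eventually_happens'[OF assms(1) tail] sums_summable by blast
  have "isCont (\<lambda>s. \<Sum>k. f (k + n) * s ^ k) 0"
    using r_nonzero by (intro isCont_powser[OF summable]) simp
  then have "((\<lambda>s. \<Sum>k. f (k + n) * s ^ k) \<longlongrightarrow> f n) F"
    by (intro tendsto_mono[OF assms(2)]) (simp add: isCont_def)
  moreover have "\<forall>\<^sub>F s in F. (\<Sum>k. f (k + n) * s ^ k) = 0"
    using tail by eventually_elim (simp add: sums_iff)
  ultimately show ?case
    using tendsto_unique[OF assms(1) _ tendsto_eventually] by blast
qed

lemma powser_unique:
  fixes f g :: "nat \<Rightarrow> 'a::{real_normed_field, banach}"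
  assumes "F \<noteq> bot" "F \<le> at 0"
    and "\<forall>\<^sub>F s in F. (\<lambda>k. f k * s ^ k) sums v s" "\<forall>\<^sub>F s in F. (\<lambda>k. g k * s ^ k) sums v s"
  shows "f = g"
proof -
  have "\<forall>\<^sub>F s in F. (\<lambda>k. (f k - g k) * s ^ k) sums 0"
    using assms(3,4) by eventually_elim (drule (1) sums_diff, simp add: algebra_simps)
  from powser_coeffs_zero[OF assms(1,2) this] show ?thesis by auto
qed

lemma has_sum_remainder_bound:
  fixes f :: "'a \<Rightarrow> 'b::banach" and g :: "'a \<Rightarrow> real"
  assumes "(f has_sum v) UNIV" "finite E" "g summable_on UNIV" "\<And>i. 0 \<le> g i" "0 \<le> S"
    and bound: "\<And>i. i \<notin> E \<Longrightarrow> norm (f i) \<le> g i * S"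
  shows "norm (v - sum f E) \<le> infsum g UNIV * S"
proof -
  have remainder: "(f has_sum v - sum f E) (UNIV - E)"
    by (intro has_sum_Diff has_sum_finite assms) auto
  have summable: "g summable_on UNIV - E"
    using assms(3) by (rule summable_on_subset) auto
  have "norm (v - sum f E) \<le> infsum g (UNIV - E) * S"
    by (rule norm_infsum_le[OF remainder has_sum_cmult_left[OF has_sum_infsum[OF summable]]])
       (use bound in auto)
  also have "infsum g (UNIV - E) \<le> infsum g UNIV"
    by (rule infsum_mono2) (use assms summable in auto)
  finally show ?thesis using assms(5) by (simp add: mult_right_mono)
qed

subsection \<open>Quadratic forms and ellipticity\<close>

lemma linear_cmult: "linear f \<Longrightarrow> linear (\<lambda>x. c * f x)" for f :: "'a::real_vector \<Rightarrow> real"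
  using linear_compose_scale_right[of f c] by simp

definition quadratic_form :: "(real^'n \<Rightarrow> real) \<Rightarrow> bool" where
  "quadratic_form q \<longleftrightarrow> (\<exists>K. \<forall>x. q x = x \<bullet> (K *v x))"

definition form_hessian :: "(real^'n \<Rightarrow> real) \<Rightarrow> real^'n^'n" where
  "form_hessian q = (\<chi> i j. q (axis i 1 + axis j 1) - q (axis i 1) - q (axis j 1))"

lemma matrix_vector_mult_outer_product:
  fixes a b :: "real^'n"
  shows "(\<chi> i j. a $ i * b $ j) *v x = (b \<bullet> x) *\<^sub>R a"
  by (simp add: vec_eq_iff matrix_vector_mult_def inner_vec_def sum_distrib_left mult_ac)

lemma quadratic_form_mult:
  fixes f g :: "real^'n \<Rightarrow> real"
  assumes "linear f" "linear g"
  shows "quadratic_form (\<lambda>x. f x * g x)"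
proof -
  have "f x = adjoint f 1 \<bullet> x" "g x = adjoint g 1 \<bullet> x" for x
    using adjoint_works[OF assms(1), of x 1] adjoint_works[OF assms(2), of x 1]
    by (simp_all add: inner_commute)
  then have "f x * g x = x \<bullet> ((\<chi> i j. adjoint f 1 $ i * adjoint g 1 $ j) *v x)" for x
    by (simp add: matrix_vector_mult_outer_product inner_commute)
  then show ?thesis unfolding quadratic_form_def by blast
qed

lemma quadratic_form_norm_power2: "quadratic_form (\<lambda>x. (norm x)\<^sup>2)"
  unfolding quadratic_form_def by (rule exI[of _ "mat 1"]) (simp add: power2_norm_eq_inner)

lemma quadratic_form_cmult: "quadratic_form q \<Longrightarrow> quadratic_form (\<lambda>x. c * q x)"
  unfolding quadratic_form_def by (metis scaleR_matrix_vector_assoc inner_scaleR_right)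

lemma quadratic_form_add:
  "quadratic_form p \<Longrightarrow> quadratic_form q \<Longrightarrow> quadratic_form (\<lambda>x. p x + q x)"
  unfolding quadratic_form_def by (metis matrix_vector_mult_add_rdistrib inner_add_right)

lemma quadratic_form_sum:
  assumes "\<And>i. i \<in> I \<Longrightarrow> quadratic_form (q i)"
  shows "quadratic_form (\<lambda>x. \<Sum>i\<in>I. q i x)"
  using assms
proof (induction I rule: infinite_finite_induct)
  case (insert i I)
  then show ?case by (simp add: quadratic_form_add)
qed (use quadratic_form_cmult[OF quadratic_form_norm_power2, of 0] in simp_all)

lemma quadratic_form_scaleR: "quadratic_form q \<Longrightarrow> q (s *\<^sub>R x) = s\<^sup>2 * q x"
  by (auto simp: quadratic_form_def matrix_vector_mult_scaleR power2_eq_square)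

lemma symmetric_mat_form_hessian: "symmetric_mat (form_hessian q)"
  by (simp add: form_hessian_def symmetric_mat_def transpose_def vec_eq_iff add.commute)

lemma form_hessian_bilinear:
  assumes "\<And>x. q x = x \<bullet> (K *v x)"
  shows "form_hessian q = K + transpose K"
  by (simp add: form_hessian_def transpose_def vec_eq_iff assms matrix_vector_right_distrib
      inner_add_left inner_add_right inner_axis inner_axis' matrix_vector_mult_basis column_def)

lemma quadratic_form_expand:
  assumes "quadratic_form q"
  shows "q (x + y) = q x + (form_hessian q *v x) \<bullet> y + q y"
proof -
  obtain K where K: "\<And>x. q x = x \<bullet> (K *v x)" using assms by (auto simp: quadratic_form_def)
  have "(transpose K *v x) \<bullet> y = x \<bullet> (K *v y)"
    by (metis dot_lmul_matrix transpose_matrix_vector)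
  then show ?thesis
    unfolding form_hessian_bilinear[OF K]
    by (simp add: K matrix_vector_right_distrib matrix_vector_mult_add_rdistrib inner_add_left
        inner_add_right inner_commute)
qed

lemma inner_form_hessian:
  assumes "quadratic_form q"
  shows "x \<bullet> (form_hessian q *v x) = 2 * q x"
  using quadratic_form_expand[OF assms, of x x] quadratic_form_scaleR[OF assms, of 2 x]
  by (simp add: inner_commute scaleR_2)

lemma form_hessian_add:
  "form_hessian (\<lambda>x. p x + q x) = form_hessian p + form_hessian q"
  by (simp add: form_hessian_def vec_eq_iff)

lemma trace_form_hessian:
  assumes "quadratic_form q"
  shows "trace (form_hessian q) = 2 * (\<Sum>i\<in>UNIV. q (axis i 1))"
  using quadratic_form_scaleR[OF assms, of 2]
  by (simp add: trace_def form_hessian_def sum_distrib_left flip: scaleR_2)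

lemma sum_inner_axis_power2: "(\<Sum>i\<in>UNIV. (z \<bullet> axis i 1)\<^sup>2) = (norm (z :: real^'n))\<^sup>2"
  by (simp only: inner_axis power2_norm_eq_inner) (simp add: inner_vec_def power2_eq_square)

locale elliptic_operator =
  fixes F :: "real^'n^'n \<Rightarrow> real" and lam Lam :: real
  assumes lam_pos: "0 < lam" and lam_le_Lam: "lam \<le> Lam"
    and elliptic: "uniformly_elliptic lam Lam F"
begin

lemma F_add_form_bounds:
  assumes "quadratic_form p" "quadratic_form q" "\<And>x. 0 \<le> q x"
  defines "increment \<equiv> F (form_hessian (\<lambda>x. p x + q x)) - F (form_hessian p)"
  shows "2 * lam * (\<Sum>i\<in>UNIV. q (axis i 1)) \<le> increment"
    and "increment \<le> 2 * Lam * (\<Sum>i\<in>UNIV. q (axis i 1))"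
proof -
  have "psd_mat (form_hessian q)"
    using assms(3) by (simp add: psd_mat_def inner_form_hessian[OF assms(2)])
  then have "lam * trace (form_hessian q) \<le> increment \<and> increment \<le> Lam * trace (form_hessian q)"
    using elliptic symmetric_mat_form_hessian
    unfolding uniformly_elliptic_def increment_def form_hessian_add by blast
  then show "2 * lam * (\<Sum>i\<in>UNIV. q (axis i 1)) \<le> increment"
    and "increment \<le> 2 * Lam * (\<Sum>i\<in>UNIV. q (axis i 1))"
    by (simp_all add: trace_form_hessian[OF assms(2)] mult_ac)
qed

lemma F_mono:
  assumes "quadratic_form p" "quadratic_form q" "\<And>x. p x \<le> q x"
  shows "F (form_hessian p) \<le> F (form_hessian q)"
proof -
  have "quadratic_form (\<lambda>x. q x - p x)"
    using quadratic_form_add[OF assms(2) quadratic_form_cmult[OF assms(1), of "-1"]] by simp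
  from F_add_form_bounds(1)[OF assms(1) this]
  have "2 * lam * (\<Sum>i\<in>UNIV. q (axis i 1) - p (axis i 1)) \<le> F (form_hessian q) - F (form_hessian p)"
    using assms(3) by simp
  moreover have "0 \<le> 2 * lam * (\<Sum>i\<in>UNIV. q (axis i 1) - p (axis i 1))"
    using lam_pos assms(3) by (intro mult_nonneg_nonneg sum_nonneg) auto
  ultimately show ?thesis by simp
qed

lemma F_upper_bound:
  assumes "quadratic_form p" "quadratic_form q" "0 \<le> c" "0 \<le> e"
    and form_le: "\<And>x. q x \<le> p x + c * (norm x)\<^sup>2 - e * (z \<bullet> x)\<^sup>2"
  shows "F (form_hessian q)
    \<le> F (form_hessian p) + 2 * Lam * CARD('n) * c - 2 * lam * e * (norm z)\<^sup>2"
proof -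
  define r where "r x = p x + c * (norm x)\<^sup>2 + (- e) * ((z \<bullet> x) * (z \<bullet> x))" for x
  have square: "quadratic_form (\<lambda>x. (z \<bullet> x) * (z \<bullet> x))"
    by (intro quadratic_form_mult bounded_linear.linear bounded_linear_inner_right)
  have quadratic: "quadratic_form r"
    unfolding r_def
    by (intro quadratic_form_add quadratic_form_cmult quadratic_form_norm_power2 assms square)
  have "F (form_hessian q) \<le> F (form_hessian r)"
    by (rule F_mono[OF assms(2) quadratic]) (use form_le in \<open>simp add: r_def power2_eq_square\<close>)
  moreover have "2 * lam * (e * (norm z)\<^sup>2)
      \<le> F (form_hessian (\<lambda>x. r x + e * ((z \<bullet> x) * (z \<bullet> x)))) - F (form_hessian r)"
    using F_add_form_bounds(1)[OF quadratic quadratic_form_cmult[OF square, of e]] assms(4)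
    by (simp add: sum_inner_axis_power2 flip: sum_distrib_left power2_eq_square)
  moreover have "(\<lambda>x. r x + e * ((z \<bullet> x) * (z \<bullet> x))) = (\<lambda>x. p x + c * (norm x)\<^sup>2)"
    by (simp add: r_def)
  moreover have "F (form_hessian (\<lambda>x. p x + c * (norm x)\<^sup>2)) - F (form_hessian p)
      \<le> 2 * Lam * (CARD('n) * c)"
    using F_add_form_bounds(2)[OF assms(1) quadratic_form_cmult[OF quadratic_form_norm_power2]]
      assms(3) by simp
  ultimately show ?thesis by (simp add: mult_ac)
qed

lemma F_lipschitz:
  assumes "quadratic_form p" "quadratic_form q" "0 \<le> c" "\<And>x. \<bar>p x - q x\<bar> \<le> c * (norm x)\<^sup>2"
  shows "\<bar>F (form_hessian p) - F (form_hessian q)\<bar> \<le> 2 * Lam * CARD('n) * c"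
proof -
  have "p x \<le> q x + c * (norm x)\<^sup>2" "q x \<le> p x + c * (norm x)\<^sup>2" for x
    using assms(4)[of x] by (auto simp: abs_le_iff)
  then show ?thesis
    using F_upper_bound[OF assms(1,2,3), of 0 0] F_upper_bound[OF assms(2,1,3), of 0 0]
    by (simp add: abs_le_iff)
qed

end

subsection \<open>Backward jets\<close>

definition time_coeff :: "(nat \<Rightarrow> nat \<Rightarrow> real^'n \<Rightarrow> real) \<Rightarrow> real^'n \<Rightarrow> nat \<Rightarrow> real" where
  "time_coeff a x k = (\<Sum>\<^sub>\<infinity>n. a k n x)"

definition space_coeff :: "(nat \<Rightarrow> nat \<Rightarrow> real^'n \<Rightarrow> real) \<Rightarrow> real \<Rightarrow> nat \<Rightarrow> real^'n \<Rightarrow> real" where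
  "space_coeff a \<tau> n x = (\<Sum>\<^sub>\<infinity>k. a k n x * \<tau> ^ k)"

definition time_deriv_coeff ::
  "(nat \<Rightarrow> nat \<Rightarrow> real^'n \<Rightarrow> real) \<Rightarrow> nat \<Rightarrow> nat \<Rightarrow> real^'n \<Rightarrow> real" where
  "time_deriv_coeff a k n x = real (Suc k) * a (Suc k) n x"

definition time_deriv_majorant :: "(nat \<Rightarrow> nat \<Rightarrow> real) \<Rightarrow> nat \<Rightarrow> nat \<Rightarrow> real" where
  "time_deriv_majorant A k n = real (Suc k) * A (Suc k) n"

text \<open>
  \<open>a k n\<close> is the part of a Taylor series of degree \<open>k\<close> in time and homogeneous degree \<open>n\<close> in
  space, and \<open>A k n\<close> bounds it on the unit ball.
\<close>

locale jet_coefficients =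
  fixes \<rho> :: real and a :: "nat \<Rightarrow> nat \<Rightarrow> real^'n \<Rightarrow> real" and A :: "nat \<Rightarrow> nat \<Rightarrow> real"
  assumes radius_pos: "0 < \<rho>"
    and majorant_summable: "(\<lambda>(k, n). A k n * \<rho> ^ (k + n)) summable_on UNIV"
    and coeff_bound: "\<bar>a k n x\<bar> \<le> A k n * norm x ^ n"
    and coeff_scaleR: "a k n (s *\<^sub>R x) = s ^ n * a k n x"
    and linear_coeff: "linear (a k 1)"
    and quadratic_coeff: "quadratic_form (a k 2)"
begin

lemma majorant_nonneg: "0 \<le> A k n"
  using order_trans[OF abs_ge_zero coeff_bound[of k n "axis undefined 1"]] by simp

lemma coeff_degree_0: "a k 0 x = a k 0 0"
  using coeff_scaleR[of k 0 0 x] by simp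

lemma coeff_at_0: "n \<noteq> 0 \<Longrightarrow> a k n 0 = 0"
  using coeff_scaleR[of k n 0 0] by (simp add: power_0_left)

lemma term_bound: "\<bar>a k n x * \<tau> ^ k\<bar> \<le> A k n * norm x ^ n * \<bar>\<tau>\<bar> ^ k"
  unfolding abs_mult power_abs by (intro mult_right_mono coeff_bound) auto

lemma series_summable:
  assumes "\<bar>\<tau>\<bar> \<le> \<rho>" "norm x \<le> \<rho>"
  shows "(\<lambda>(k, n). a k n x * \<tau> ^ k) summable_on UNIV"
proof (rule abs_summable_summable,
    rule Infinite_Sum.abs_summable_on_comparison_test'[OF majorant_summable], clarify)
  fix k n
  have "A k n * (norm x ^ n * \<bar>\<tau>\<bar> ^ k) \<le> A k n * (\<rho> ^ n * \<rho> ^ k)"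
    using assms radius_pos by (intro mult_left_mono mult_mono power_mono majorant_nonneg) auto
  then show "norm (a k n x * \<tau> ^ k) \<le> A k n * \<rho> ^ (k + n)"
    using term_bound[of k n x \<tau>] by (simp add: power_add mult_ac)
qed

lemma time_coeff_has_sum:
  assumes "norm x \<le> \<rho>"
  shows "((\<lambda>n. a k n x) has_sum time_coeff a x k) UNIV"
proof -
  have "(\<lambda>(k, n). a k n x * \<rho> ^ k) summable_on UNIV \<times> UNIV"
    using series_summable[of \<rho> x] assms radius_pos by simp
  from summable_on_SigmaD1[OF this, of k] have "(\<lambda>n. a k n x * \<rho> ^ k) summable_on UNIV" by simp
  then have "(\<lambda>n. a k n x) summable_on UNIV"
    using radius_pos by (simp add: summable_on_cmult_left')
  then show ?thesis unfolding time_coeff_def by (rule has_sum_infsum)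
qed

lemma time_series_has_sum:
  assumes "\<bar>\<tau>\<bar> \<le> \<rho>" "norm x \<le> \<rho>"
  shows "((\<lambda>k. time_coeff a x k * \<tau> ^ k) has_sum (\<Sum>\<^sub>\<infinity>(k, n). a k n x * \<tau> ^ k)) UNIV"
proof -
  have "((\<lambda>(k, n). a k n x * \<tau> ^ k) has_sum (\<Sum>\<^sub>\<infinity>(k, n). a k n x * \<tau> ^ k)) (UNIV \<times> UNIV)"
    using has_sum_infsum[OF series_summable[OF assms]] by simp
  then show ?thesis
    by (rule has_sum_SigmaD) (simp add: has_sum_cmult_left time_coeff_has_sum[OF assms(2)])
qed

lemma time_coeff_scaleR_sums:
  assumes "norm (s *\<^sub>R x) \<le> \<rho>"
  shows "(\<lambda>n. a k n x * s ^ n) sums time_coeff a (s *\<^sub>R x) k"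
  using has_sum_imp_sums[OF time_coeff_has_sum[OF assms, of k]]
  by (simp add: coeff_scaleR mult.commute)

lemma time_coeff_0: "time_coeff a 0 k = a k 0 0"
  using time_coeff_scaleR_sums[of 0 0 k] radius_pos by (simp add: sums_iff powser_zero)

lemma majorant_summable_time: "(\<lambda>k. A k n * \<rho> ^ k) summable_on UNIV"
proof -
  have "(\<lambda>(n, k). A k n * \<rho> ^ (k + n)) summable_on UNIV \<times> UNIV"
    using majorant_summable by (subst summable_on_swap) simp
  from summable_on_SigmaD1[OF this, of n] have "(\<lambda>k. (A k n * \<rho> ^ k) * \<rho> ^ n) summable_on UNIV"
    by (simp add: power_add mult.assoc)
  then show ?thesis using radius_pos by (simp add: summable_on_cmult_left')
qed

lemma space_coeff_has_sum:
  assumes "\<bar>\<tau>\<bar> \<le> \<rho>"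
  shows "((\<lambda>k. a k n x * \<tau> ^ k) has_sum space_coeff a \<tau> n x) UNIV"
  unfolding space_coeff_def
proof (rule has_sum_infsum, rule abs_summable_summable)
  have majorant: "(\<lambda>k. (A k n * \<rho> ^ k) * norm x ^ n) summable_on UNIV"
    by (rule summable_on_cmult_left[OF majorant_summable_time])
  show "(\<lambda>k. norm (a k n x * \<tau> ^ k)) summable_on UNIV"
  proof (rule Infinite_Sum.abs_summable_on_comparison_test'[OF majorant])
    fix k
    have "A k n * norm x ^ n * \<bar>\<tau>\<bar> ^ k \<le> A k n * norm x ^ n * \<rho> ^ k"
      using assms by (intro mult_left_mono power_mono mult_nonneg_nonneg majorant_nonneg) auto
    then show "norm (a k n x * \<tau> ^ k) \<le> (A k n * \<rho> ^ k) * norm x ^ n"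
      using term_bound[of k n x \<tau>] by (simp add: mult_ac)
  qed
qed

lemma space_coeff_time_0: "space_coeff a 0 n x = a 0 n x"
  using has_sum_imp_sums[OF space_coeff_has_sum[of 0 n x]] radius_pos
  by (simp add: sums_iff powser_zero)

lemma space_coeff_taylor:
  "\<exists>C\<ge>0. \<forall>\<tau> x. \<bar>\<tau>\<bar> \<le> \<rho> \<longrightarrow>
     \<bar>space_coeff a \<tau> n x - (\<Sum>k<K. a k n x * \<tau> ^ k)\<bar> \<le> C * \<bar>\<tau>\<bar> ^ K * norm x ^ n"
proof (intro exI[of _ "(\<Sum>\<^sub>\<infinity>k. A k n * \<rho> ^ k) / \<rho> ^ K"] conjI allI impI)
  show "0 \<le> (\<Sum>\<^sub>\<infinity>k. A k n * \<rho> ^ k) / \<rho> ^ K"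
    using radius_pos majorant_nonneg by (intro divide_nonneg_nonneg infsum_nonneg) auto
  fix \<tau> x assume \<tau>: "\<bar>\<tau>\<bar> \<le> \<rho>"
  have "norm (space_coeff a \<tau> n x - (\<Sum>k<K. a k n x * \<tau> ^ k))
      \<le> (\<Sum>\<^sub>\<infinity>k. A k n * \<rho> ^ k) * ((\<bar>\<tau>\<bar> / \<rho>) ^ K * norm x ^ n)"
  proof (rule has_sum_remainder_bound[OF space_coeff_has_sum[OF \<tau>] _ majorant_summable_time])
    fix k assume "k \<notin> {..<K}"
    then have "(\<bar>\<tau>\<bar> / \<rho>) ^ k \<le> (\<bar>\<tau>\<bar> / \<rho>) ^ K"
      using \<tau> radius_pos by (intro power_decreasing) auto
    then have "(A k n * \<rho> ^ k) * ((\<bar>\<tau>\<bar> / \<rho>) ^ k * norm x ^ n)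
        \<le> (A k n * \<rho> ^ k) * ((\<bar>\<tau>\<bar> / \<rho>) ^ K * norm x ^ n)"
      using radius_pos majorant_nonneg[of k n] by (intro mult_left_mono mult_right_mono) auto
    then show "norm (a k n x * \<tau> ^ k) \<le> (A k n * \<rho> ^ k) * ((\<bar>\<tau>\<bar> / \<rho>) ^ K * norm x ^ n)"
      using term_bound[of k n x \<tau>] radius_pos by (simp add: power_divide mult_ac)
  qed (use radius_pos majorant_nonneg in auto)
  then show "\<bar>space_coeff a \<tau> n x - (\<Sum>k<K. a k n x * \<tau> ^ k)\<bar>
      \<le> (\<Sum>\<^sub>\<infinity>k. A k n * \<rho> ^ k) / \<rho> ^ K * \<bar>\<tau>\<bar> ^ K * norm x ^ n"
    by (simp add: power_divide)
qed

lemma shrink_coefficients: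
  assumes "0 < r" "r \<le> \<rho>"
  shows "jet_coefficients r a A"
proof (rule jet_coefficients.intro)
  have "A k n * r ^ (k + n) \<le> A k n * \<rho> ^ (k + n)" for k n
    using assms by (intro mult_left_mono power_mono majorant_nonneg) auto
  then show "(\<lambda>(k, n). A k n * r ^ (k + n)) summable_on UNIV"
    by (intro summable_on_comparison_test[OF majorant_summable])
       (use assms majorant_nonneg in auto)
qed (use assms coeff_bound coeff_scaleR linear_coeff quadratic_coeff in auto)

lemma time_deriv_majorant_summable:
  "(\<lambda>(k, n). time_deriv_majorant A k n * (\<rho> / 2) ^ (k + n)) summable_on UNIV"
proof (rule summable_on_comparison_test)
  have "((\<lambda>(k, n). A k n * \<rho> ^ (k + n)) \<circ> (\<lambda>(k, n). (Suc k, n))) summable_on UNIV"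
    by (subst summable_on_reindex[symmetric])
      (auto intro!: inj_onI summable_on_subset[OF majorant_summable])
  from summable_on_cmult_right[OF this, of "1 / \<rho>"]
  show "(\<lambda>(k, n). 1 / \<rho> * (A (Suc k) n * \<rho> ^ (Suc k + n))) summable_on UNIV"
    by (simp add: o_def case_prod_unfold)
  have "time_deriv_majorant A k n * (\<rho> / 2) ^ (k + n) \<le> 1 / \<rho> * (A (Suc k) n * \<rho> ^ (Suc k + n))"
    for k n
  proof -
    have "Suc k \<le> (2 :: nat) ^ (k + n)" using less_exp[of "k + n"] by linarith
    then have "real (Suc k) \<le> real (2 ^ (k + n))" by (simp only: of_nat_le_iff)
    then have "real (Suc k) / 2 ^ (k + n) * (A (Suc k) n * \<rho> ^ (k + n))
        \<le> 1 * (A (Suc k) n * \<rho> ^ (k + n))"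
      using radius_pos majorant_nonneg by (intro mult_right_mono) auto
    then show ?thesis
      using radius_pos by (simp add: time_deriv_majorant_def power_divide mult_ac del: of_nat_Suc)
  qed
  then show "(case p of (k, n) \<Rightarrow> time_deriv_majorant A k n * (\<rho> / 2) ^ (k + n))
      \<le> (case p of (k, n) \<Rightarrow> 1 / \<rho> * (A (Suc k) n * \<rho> ^ (Suc k + n)))" for p
    by (simp add: case_prod_unfold)
qed (use radius_pos majorant_nonneg in \<open>auto simp: time_deriv_majorant_def\<close>)

lemma time_deriv_coefficients:
  "jet_coefficients (\<rho> / 2) (time_deriv_coeff a) (time_deriv_majorant A)"
proof (rule jet_coefficients.intro)
  show "\<bar>time_deriv_coeff a k n x\<bar> \<le> time_deriv_majorant A k n * norm x ^ n" for k n x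
    using coeff_bound[of "Suc k" n x]
    by (simp add: time_deriv_coeff_def time_deriv_majorant_def abs_mult mult.assoc mult_left_mono
        del: of_nat_Suc)
  show "linear (time_deriv_coeff a k 1)" for k
    unfolding time_deriv_coeff_def[abs_def] by (rule linear_cmult[OF linear_coeff])
  show "quadratic_form (time_deriv_coeff a k 2)" for k
    unfolding time_deriv_coeff_def[abs_def] by (rule quadratic_form_cmult[OF quadratic_coeff])
  show "time_deriv_coeff a k n (s *\<^sub>R x) = s ^ n * time_deriv_coeff a k n x" for k n s x
    by (simp add: time_deriv_coeff_def coeff_scaleR)
qed (use radius_pos time_deriv_majorant_summable in simp_all)

end

text \<open>
  The expansion is only required at nonpositive times, so that at \<open>t = 0\<close> it sees \<open>u\<close> and not
  an analytic continuation of \<open>u\<close>.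
\<close>

locale jet = jet_coefficients \<rho> a A
  for u :: "real \<times> (real^'n) \<Rightarrow> real" and t :: real and y :: "real^'n" and \<rho> a A +
  assumes expansion: "\<bar>\<tau>\<bar> \<le> \<rho> \<Longrightarrow> norm x \<le> \<rho> \<Longrightarrow> t + \<tau> \<le> 0 \<Longrightarrow>
      ((\<lambda>(k, n). a k n x * \<tau> ^ k) has_sum u (t + \<tau>, y + x)) UNIV"
begin

lemma time_expansion:
  assumes "\<bar>\<tau>\<bar> \<le> \<rho>" "norm x \<le> \<rho>" "t + \<tau> \<le> 0"
  shows "(\<lambda>k. time_coeff a x k * \<tau> ^ k) sums u (t + \<tau>, y + x)"
  using has_sum_imp_sums[OF time_series_has_sum[OF assms(1,2)]] infsumI[OF expansion[OF assms]]
  by simp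

lemma center_expansion:
  "\<bar>\<tau>\<bar> \<le> \<rho> \<Longrightarrow> t + \<tau> \<le> 0 \<Longrightarrow> (\<lambda>k. a k 0 0 * \<tau> ^ k) sums u (t + \<tau>, y)"
  using time_expansion[of \<tau> 0] radius_pos by (simp add: time_coeff_0)

lemma center_value: "t \<le> 0 \<Longrightarrow> u (t, y) = a 0 0 0"
  using center_expansion[of 0] radius_pos by (simp add: sums_iff powser_zero)

lemma space_expansion:
  assumes "\<bar>\<tau>\<bar> \<le> \<rho>" "t + \<tau> \<le> 0" "norm (s *\<^sub>R x) \<le> \<rho>"
  shows "(\<lambda>n. space_coeff a \<tau> n x * s ^ n) sums u (t + \<tau>, y + s *\<^sub>R x)"
proof -
  have "((\<lambda>(k, n). a k n (s *\<^sub>R x) * \<tau> ^ k) has_sum u (t + \<tau>, y + s *\<^sub>R x)) (UNIV \<times> UNIV)"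
    using expansion[OF assms(1,3,2)] by simp
  then have "((\<lambda>(n, k). (a k n x * \<tau> ^ k) * s ^ n) has_sum u (t + \<tau>, y + s *\<^sub>R x))
      (UNIV \<times> UNIV)"
    by (subst (asm) has_sum_swap) (simp add: coeff_scaleR mult_ac)
  then have "((\<lambda>n. space_coeff a \<tau> n x * s ^ n) has_sum u (t + \<tau>, y + s *\<^sub>R x)) UNIV"
    by (rule has_sum_SigmaD) (simp add: has_sum_cmult_left space_coeff_has_sum[OF assms(1)])
  then show ?thesis by (rule has_sum_imp_sums)
qed

lemma space_coeff_center:
  "\<bar>\<tau>\<bar> \<le> \<rho> \<Longrightarrow> t + \<tau> \<le> 0 \<Longrightarrow> space_coeff a \<tau> 0 0 = u (t + \<tau>, y)"
  using space_expansion[of \<tau> 0 0] radius_pos by (simp add: sums_iff powser_zero)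

lemma center_taylor:
  "\<exists>C. \<forall>\<tau>. \<bar>\<tau>\<bar> \<le> \<rho> \<longrightarrow> t + \<tau> \<le> 0 \<longrightarrow>
     \<bar>u (t + \<tau>, y) - (\<Sum>k<K. a k 0 0 * \<tau> ^ k)\<bar> \<le> C * \<bar>\<tau>\<bar> ^ K"
proof -
  obtain C where taylor: "\<And>\<tau>. \<bar>\<tau>\<bar> \<le> \<rho> \<Longrightarrow>
      \<bar>space_coeff a \<tau> 0 0 - (\<Sum>k<K. a k 0 0 * \<tau> ^ k)\<bar> \<le> C * \<bar>\<tau>\<bar> ^ K * norm (0 :: real^'n) ^ 0"
    using space_coeff_taylor[of 0 K] by blast
  show ?thesis
    by (intro exI[of _ C] allI impI) (use taylor space_coeff_center in force)
qed

lemma eventually_cong: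
  assumes "\<forall>\<^sub>F p in nhds (t, y). fst p \<le> 0 \<longrightarrow> v p = u p"
  shows "\<exists>r. jet v t y r a A"
proof -
  obtain e where "0 < e" and agree: "\<And>p. dist p (t, y) < e \<Longrightarrow> fst p \<le> 0 \<Longrightarrow> v p = u p"
    using assms by (auto simp: eventually_nhds_metric)
  define r where "r = min \<rho> (e / 3)"
  have radius: "0 < r" "r \<le> \<rho>" "r \<le> e / 3" using radius_pos \<open>0 < e\<close> by (auto simp: r_def)
  have "jet v t y r a A"
  proof (intro jet.intro jet_axioms.intro shrink_coefficients radius)
    fix \<tau> :: real and x :: "real^'n"
    assume close: "\<bar>\<tau>\<bar> \<le> r" "norm x \<le> r" "t + \<tau> \<le> 0"
    have "dist (t + \<tau>, y + x) (t, y) < e"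
      using norm_Pair_le[of \<tau> x] close radius \<open>0 < e\<close> by (simp add: dist_norm)
    with agree close expansion[of \<tau> x] radius
    show "((\<lambda>(k, n). a k n x * \<tau> ^ k) has_sum v (t + \<tau>, y + x)) UNIV" by simp
  qed
  then show ?thesis ..
qed

end

lemma (in jet_coefficients) eventually_ray_in_domain: "\<forall>\<^sub>F s in nhds 0. norm (s *\<^sub>R x) < \<rho>"
  by (rule eventually_along_ray[OF eventually_norm_less[OF radius_pos]])

lemma (in jet) eventually_time_expansion:
  assumes "norm x \<le> \<rho>"
  shows "\<forall>\<^sub>F s in nhds 0. t + s \<le> 0 \<longrightarrow> (\<lambda>k. time_coeff a x k * s ^ k) sums u (t + s, y + x)"
  using eventually_norm_less[OF radius_pos]
  by eventually_elim (use time_expansion assms in simp)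

lemma (in jet) eventually_space_expansion:
  assumes "\<bar>\<tau>\<bar> \<le> \<rho>" "t + \<tau> \<le> 0"
  shows "\<forall>\<^sub>F s in nhds 0. (\<lambda>n. space_coeff a \<tau> n x * s ^ n) sums u (t + \<tau>, y + s *\<^sub>R x)"
  using eventually_ray_in_domain[of x]
  by eventually_elim (use space_expansion assms in simp)

lemma jet_time_coeff_eqI:
  assumes "jet u t y \<rho> a A" "jet v t y' r b B" "norm x \<le> \<rho>" "norm x' \<le> r"
    and F: "F \<noteq> bot" "F \<le> at 0" "\<forall>\<^sub>F s in F. t + s \<le> 0"
    and agree: "\<forall>\<^sub>F s in F. u (t + s, y + x) = v (t + s, y' + x')"
  shows "time_coeff a x = time_coeff b x'"
proof (rule powser_unique[OF F(1,2)])
  have nhds: "eventually P F" if "eventually P (nhds 0)" for P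
    by (rule filter_leD[OF order_trans[OF F(2) at_within_le_nhds] that])
  show "\<forall>\<^sub>F s in F. (\<lambda>k. time_coeff a x k * s ^ k) sums u (t + s, y + x)"
    using nhds[OF jet.eventually_time_expansion[OF assms(1,3)]] F(3) by eventually_elim simp
  show "\<forall>\<^sub>F s in F. (\<lambda>k. time_coeff b x' k * s ^ k) sums u (t + s, y + x)"
    using nhds[OF jet.eventually_time_expansion[OF assms(2,4)]] F(3) agree by eventually_elim simp
qed

lemma jet_coeff_eqI:
  assumes "jet u t y \<rho> a A" "jet v t y r b B"
    and agree: "\<forall>\<^sub>F x in nhds 0. time_coeff a x k = time_coeff b x k"
  shows "a k n x = b k n x"
proof -
  interpret u: jet u t y \<rho> a A by fact
  interpret v: jet v t y r b B by fact
  have "(\<lambda>n. a k n x) = (\<lambda>n. b k n x)"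
  proof (rule powser_unique[OF _ at_le])
    show "\<forall>\<^sub>F s in at_right 0. (\<lambda>n. a k n x * s ^ n) sums time_coeff a (s *\<^sub>R x) k"
      using eventually_nhds_imp_at_right[OF u.eventually_ray_in_domain[of x]]
      by eventually_elim (simp add: u.time_coeff_scaleR_sums)
    show "\<forall>\<^sub>F s in at_right 0. (\<lambda>n. b k n x * s ^ n) sums time_coeff a (s *\<^sub>R x) k"
      using eventually_nhds_imp_at_right[OF v.eventually_ray_in_domain[of x]]
        eventually_nhds_imp_at_right[OF eventually_along_ray[where x = x, OF agree]]
      by eventually_elim (simp add: v.time_coeff_scaleR_sums)
  qed auto
  then show ?thesis by metis
qed

lemma eventually_at_left_0_nonpos: "t \<le> 0 \<Longrightarrow> \<forall>\<^sub>F s in at_left 0. t + s \<le> (0::real)"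
  by (auto simp: eventually_at_left_field intro!: exI[of _ "-1"])

lemma jet_unique:
  assumes "jet u t y \<rho> a A" "jet u t y r b B" "t \<le> 0"
  shows "a = b"
proof (intro ext jet_coeff_eqI[OF assms(1,2)])
  interpret a: jet u t y \<rho> a A by fact
  interpret b: jet u t y r b B by fact
  fix k
  show "\<forall>\<^sub>F x in nhds 0. time_coeff a x k = time_coeff b x k"
    using eventually_norm_less[OF a.radius_pos] eventually_norm_less[OF b.radius_pos]
  proof eventually_elim
    case (elim x)
    then have "time_coeff a x = time_coeff b x"
      using eventually_at_left_0_nonpos[OF assms(3)]
      by (intro jet_time_coeff_eqI[OF assms(1,2), where F = "at_left 0"] at_le) auto
    then show ?case by simp
  qed
qed

lemma (in jet) time_coeff_eq_shifted_center:
  assumes "jet u t (y + x) r b B" "norm x \<le> \<rho>" "t \<le> 0"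
  shows "time_coeff a x k = b k 0 0"
proof -
  interpret b: jet u t "y + x" r b B by fact
  have "time_coeff a x = time_coeff b 0"
    using eventually_at_left_0_nonpos[OF assms(3)] assms(2) b.radius_pos
    by (intro jet_time_coeff_eqI[OF jet_axioms assms(1), where F = "at_left 0"] at_le) auto
  then show ?thesis by (simp add: b.time_coeff_0)
qed

lemma (in jet) space_coeff_eq_shifted_center:
  assumes "jet u (t + \<tau>) y r b B" "\<bar>\<tau>\<bar> \<le> \<rho>" "t + \<tau> \<le> 0"
  shows "space_coeff a \<tau> n x = b 0 n x"
proof -
  interpret b: jet u "t + \<tau>" y r b B by fact
  have "(\<lambda>n. space_coeff a \<tau> n x) = (\<lambda>n. space_coeff b 0 n x)"
  proof (rule powser_unique[OF _ at_le])
    show "\<forall>\<^sub>F s in at_right 0. (\<lambda>n. space_coeff a \<tau> n x * s ^ n) sums u (t + \<tau>, y + s *\<^sub>R x)"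
      by (intro eventually_nhds_imp_at_right eventually_space_expansion assms)
    show "\<forall>\<^sub>F s in at_right 0. (\<lambda>n. space_coeff b 0 n x * s ^ n) sums u (t + \<tau>, y + s *\<^sub>R x)"
      using eventually_nhds_imp_at_right[OF b.eventually_space_expansion[of 0 x]]
        b.radius_pos assms(3) by simp
  qed auto
  then show ?thesis by (metis b.space_coeff_time_0)
qed

subsection \<open>Derivatives of backward jets\<close>

definition taylor_polynomial ::
  "(nat \<Rightarrow> nat \<Rightarrow> real^'n \<Rightarrow> real) \<Rightarrow> real \<Rightarrow> real^'n \<Rightarrow> real" where
  "taylor_polynomial a \<tau> x = a 0 0 0 + a 1 0 0 * \<tau> + a 0 1 x + a 0 2 x"

definition parabolic_remainder :: "real \<Rightarrow> real \<Rightarrow> real" where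
  "parabolic_remainder \<tau> r = \<tau>\<^sup>2 + \<tau> * r + r ^ 3"

lemma monomial_le_parabolic_remainder:
  assumes "0 \<le> \<tau>" "\<tau> \<le> 1" "0 \<le> r" "r \<le> 1" "(k, n) \<notin> {(0, 0), (1, 0), (0, 1), (0, 2)}"
  shows "\<tau> ^ k * r ^ n \<le> parabolic_remainder \<tau> r"
proof -
  have nonneg: "0 \<le> \<tau>\<^sup>2" "0 \<le> \<tau> * r" "0 \<le> r ^ 3" using assms(1,3) by auto
  have "k = 0 \<and> n \<ge> 3 \<or> k = 1 \<and> n \<ge> 1 \<or> k \<ge> 2"
    using assms(5) by simp presburger
  then consider "k = 0" "n \<ge> 3" | "k = 1" "n \<ge> 1" | "k \<ge> 2" by blast
  then show ?thesis
    unfolding parabolic_remainder_def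
  proof cases
    case 1
    then have "r ^ n \<le> r ^ 3" using assms(3,4) by (intro power_decreasing) auto
    then show "\<tau> ^ k * r ^ n \<le> \<tau>\<^sup>2 + \<tau> * r + r ^ 3"
      using nonneg unfolding \<open>k = 0\<close> power_0 mult_1 by linarith
  next
    case 2
    then have "\<tau> * r ^ n \<le> \<tau> * r ^ 1"
      using assms(1-4) by (intro mult_left_mono power_decreasing) auto
    then show "\<tau> ^ k * r ^ n \<le> \<tau>\<^sup>2 + \<tau> * r + r ^ 3"
      using nonneg unfolding \<open>k = 1\<close> power_one_right by linarith
  next
    case 3
    then have "\<tau> ^ k * r ^ n \<le> \<tau>\<^sup>2 * 1"
      using assms(1-4) by (intro mult_mono power_decreasing power_le_one) auto
    then show "\<tau> ^ k * r ^ n \<le> \<tau>\<^sup>2 + \<tau> * r + r ^ 3" using nonneg by linarith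
  qed
qed

lemma parabolic_remainder_rescale:
  assumes "0 < \<rho>" "0 \<le> \<tau>" "0 \<le> r"
  shows "parabolic_remainder (\<tau> / \<rho>) (r / \<rho>) \<le> (1 / \<rho>\<^sup>2 + 1 / \<rho> ^ 3) * parabolic_remainder \<tau> r"
proof -
  have "parabolic_remainder (\<tau> / \<rho>) (r / \<rho>) = 1 / \<rho>\<^sup>2 * (\<tau>\<^sup>2 + \<tau> * r) + 1 / \<rho> ^ 3 * r ^ 3"
    unfolding parabolic_remainder_def power_divide times_divide_times_eq
    by (simp add: algebra_simps power2_eq_square add_divide_distrib)
  also have "\<dots> \<le> (1 / \<rho>\<^sup>2 + 1 / \<rho> ^ 3) * (\<tau>\<^sup>2 + \<tau> * r) + (1 / \<rho>\<^sup>2 + 1 / \<rho> ^ 3) * r ^ 3"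
    using assms by (intro add_mono mult_right_mono) auto
  finally show ?thesis by (simp add: parabolic_remainder_def distrib_left)
qed

context jet
begin

lemma parabolic_taylor_normalized:
  assumes "\<bar>\<tau>\<bar> \<le> \<rho>" "norm x \<le> \<rho>" "t + \<tau> \<le> 0"
  shows "\<bar>u (t + \<tau>, y + x) - taylor_polynomial a \<tau> x\<bar>
    \<le> (\<Sum>\<^sub>\<infinity>(k, n). A k n * \<rho> ^ (k + n)) * parabolic_remainder (\<bar>\<tau>\<bar> / \<rho>) (norm x / \<rho>)"
proof -
  define E where "E = {(0 :: nat, 0 :: nat), (1, 0), (0, 1), (0, 2)}"
  let ?R = "parabolic_remainder (\<bar>\<tau>\<bar> / \<rho>) (norm x / \<rho>)"
  have unit: "0 \<le> \<bar>\<tau>\<bar> / \<rho>" "\<bar>\<tau>\<bar> / \<rho> \<le> 1" "0 \<le> norm x / \<rho>" "norm x / \<rho> \<le> 1"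
    using assms radius_pos by auto
  have "norm (u (t + \<tau>, y + x) - (\<Sum>(k, n)\<in>E. a k n x * \<tau> ^ k))
      \<le> (\<Sum>\<^sub>\<infinity>(k, n). A k n * \<rho> ^ (k + n)) * ?R"
  proof (rule has_sum_remainder_bound[OF expansion[OF assms] _ majorant_summable])
    fix p assume "p \<notin> E"
    then obtain k n where kn: "p = (k, n)" "(k, n) \<notin> E" by (cases p) auto
    then have "A k n * \<rho> ^ (k + n) * ((\<bar>\<tau>\<bar> / \<rho>) ^ k * (norm x / \<rho>) ^ n) \<le> A k n * \<rho> ^ (k + n) * ?R"
      using radius_pos majorant_nonneg
      by (intro mult_left_mono monomial_le_parabolic_remainder unit) (auto simp: E_def)
    then show "norm (case p of (k, n) \<Rightarrow> a k n x * \<tau> ^ k)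
        \<le> (case p of (k, n) \<Rightarrow> A k n * \<rho> ^ (k + n)) * ?R"
      using term_bound[of k n x \<tau>] radius_pos by (simp add: kn power_add power_divide mult_ac)
  qed (use unit radius_pos majorant_nonneg in \<open>auto simp: E_def parabolic_remainder_def\<close>)
  moreover have "(\<Sum>(k, n)\<in>E. a k n x * \<tau> ^ k) = taylor_polynomial a \<tau> x"
    by (simp add: E_def taylor_polynomial_def coeff_degree_0[of _ x])
  ultimately show ?thesis by simp
qed

lemma parabolic_taylor:
  "\<exists>M\<ge>0. \<forall>\<tau> x. \<bar>\<tau>\<bar> \<le> \<rho> \<longrightarrow> norm x \<le> \<rho> \<longrightarrow> t + \<tau> \<le> 0 \<longrightarrow>
     \<bar>u (t + \<tau>, y + x) - taylor_polynomial a \<tau> x\<bar> \<le> M * parabolic_remainder \<bar>\<tau>\<bar> (norm x)"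
proof -
  define D where "D = (\<Sum>\<^sub>\<infinity>(k, n). A k n * \<rho> ^ (k + n))"
  have "0 \<le> D"
    unfolding D_def using radius_pos majorant_nonneg by (intro infsum_nonneg) auto
  show ?thesis
  proof (intro exI[of _ "D * (1 / \<rho>\<^sup>2 + 1 / \<rho> ^ 3)"] conjI allI impI)
    show "0 \<le> D * (1 / \<rho>\<^sup>2 + 1 / \<rho> ^ 3)" using \<open>0 \<le> D\<close> radius_pos by simp
    fix \<tau> :: real and x :: "real^'n"
    assume "\<bar>\<tau>\<bar> \<le> \<rho>" "norm x \<le> \<rho>" "t + \<tau> \<le> 0"
    from parabolic_taylor_normalized[OF this]
    have "\<bar>u (t + \<tau>, y + x) - taylor_polynomial a \<tau> x\<bar>
        \<le> D * parabolic_remainder (\<bar>\<tau>\<bar> / \<rho>) (norm x / \<rho>)"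
      by (simp only: D_def)
    also have "\<dots> \<le> D * ((1 / \<rho>\<^sup>2 + 1 / \<rho> ^ 3) * parabolic_remainder \<bar>\<tau>\<bar> (norm x))"
      using \<open>0 \<le> D\<close> radius_pos by (intro mult_left_mono parabolic_remainder_rescale) auto
    finally show "\<bar>u (t + \<tau>, y + x) - taylor_polynomial a \<tau> x\<bar>
        \<le> D * (1 / \<rho>\<^sup>2 + 1 / \<rho> ^ 3) * parabolic_remainder \<bar>\<tau>\<bar> (norm x)"
      by (simp add: mult.assoc)
  qed
qed

lemma linear_taylor:
  assumes "t \<le> 0"
  shows "\<exists>B. \<forall>\<tau> x. norm (\<tau>, x) \<le> \<rho> \<longrightarrow> t + \<tau> \<le> 0 \<longrightarrow>
    \<bar>u (t + \<tau>, y + x) - u (t, y) - (a 1 0 0 * \<tau> + a 0 1 x)\<bar> \<le> B * (norm (\<tau>, x))\<^sup>2"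
proof -
  obtain M where "0 \<le> M" and taylor: "\<And>\<tau> x. \<bar>\<tau>\<bar> \<le> \<rho> \<Longrightarrow> norm x \<le> \<rho> \<Longrightarrow> t + \<tau> \<le> 0 \<Longrightarrow>
     \<bar>u (t + \<tau>, y + x) - taylor_polynomial a \<tau> x\<bar> \<le> M * parabolic_remainder \<bar>\<tau>\<bar> (norm x)"
    using parabolic_taylor by blast
  show ?thesis
  proof (intro exI[of _ "M * (2 + \<rho>) + A 0 2"] allI impI)
    fix \<tau> :: real and x :: "real^'n"
    assume small: "norm (\<tau>, x) \<le> \<rho>" "t + \<tau> \<le> 0"
    define d where "d = norm (\<tau>, x)"
    have bounds: "\<bar>\<tau>\<bar> \<le> d" "norm x \<le> d" "d \<le> \<rho>"
      using norm_fst_le[of \<tau> x] norm_snd_le[of x \<tau>] small by (auto simp: d_def)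
    have "norm x * (norm x)\<^sup>2 \<le> \<rho> * d\<^sup>2" "\<bar>\<tau>\<bar> * norm x \<le> d * d"
      using bounds by (auto intro!: mult_mono power_mono)
    moreover have "\<bar>\<tau>\<bar>\<^sup>2 \<le> d\<^sup>2" by (rule power_mono[OF bounds(1) abs_ge_zero])
    ultimately have "parabolic_remainder \<bar>\<tau>\<bar> (norm x) \<le> (2 + \<rho>) * d\<^sup>2"
      by (simp add: parabolic_remainder_def power3_eq_cube power2_eq_square distrib_right
          mult.assoc)
    then have "M * parabolic_remainder \<bar>\<tau>\<bar> (norm x) \<le> M * (2 + \<rho>) * d\<^sup>2"
      using mult_left_mono[OF _ \<open>0 \<le> M\<close>] by (simp add: mult.assoc)
    moreover have "A 0 2 * (norm x)\<^sup>2 \<le> A 0 2 * d\<^sup>2"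
      using bounds by (intro mult_left_mono power_mono majorant_nonneg) auto
    then have "\<bar>a 0 2 x\<bar> \<le> A 0 2 * d\<^sup>2" using coeff_bound[of 0 2 x] by simp
    ultimately show "\<bar>u (t + \<tau>, y + x) - u (t, y) - (a 1 0 0 * \<tau> + a 0 1 x)\<bar>
        \<le> (M * (2 + \<rho>) + A 0 2) * (norm (\<tau>, x))\<^sup>2"
      using taylor[OF order_trans[OF bounds(1,3)] order_trans[OF bounds(2,3)] small(2)]
      unfolding taylor_polynomial_def center_value[OF assms] d_def[symmetric] distrib_right
      by linarith
  qed
qed

lemma has_derivative:
  assumes "t \<le> 0"
  shows "(u has_derivative (\<lambda>(\<tau>, x). a 1 0 0 * \<tau> + a 0 1 x)) (at (t, y) within {..0} \<times> UNIV)"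
proof -
  obtain B where taylor: "\<And>\<tau> x. norm (\<tau>, x) \<le> \<rho> \<Longrightarrow> t + \<tau> \<le> 0 \<Longrightarrow>
    \<bar>u (t + \<tau>, y + x) - u (t, y) - (a 1 0 0 * \<tau> + a 0 1 x)\<bar> \<le> B * (norm (\<tau>, x))\<^sup>2"
    using linear_taylor[OF assms] by blast
  show ?thesis
  proof (rule has_derivativeI_sandwich[OF radius_pos])
    show "bounded_linear (\<lambda>(\<tau>, x). a 1 0 0 * \<tau> + a 0 1 x)"
      unfolding case_prod_unfold using linear_coeff[of 0] unfolding linear_conv_bounded_linear
      by (intro bounded_linear_add bounded_linear_const_mult bounded_linear_fst
          bounded_linear_compose[OF _ bounded_linear_snd])
    fix p :: "real \<times> (real^'n)"
    assume p: "p \<in> {..0} \<times> UNIV" "p \<noteq> (t, y)" "dist p (t, y) < \<rho>"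
    define \<tau> x where "\<tau> = fst p - t" and "x = snd p - y"
    have p_eq: "p - (t, y) = (\<tau>, x)" "p = (t + \<tau>, y + x)" by (auto simp: \<tau>_def x_def prod_eq_iff)
    have "0 < norm (\<tau>, x)" "norm (\<tau>, x) \<le> \<rho>" "t + \<tau> \<le> 0"
      using p by (auto simp: p_eq dist_norm zero_prod_def)
    with taylor[of \<tau> x]
    show "norm (u p - u (t, y) - (case p - (t, y) of (\<tau>, x) \<Rightarrow> a 1 0 0 * \<tau> + a 0 1 x))
        / norm (p - (t, y)) \<le> B * norm (p - (t, y))"
      unfolding p_eq by (simp add: pos_divide_le_eq power2_eq_square mult.assoc)
  next
    show "((\<lambda>p. B * norm (p - (t, y))) \<longlongrightarrow> 0) (at (t, y) within {..0} \<times> UNIV)"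
      by (auto intro!: tendsto_eq_intros)
  qed
qed

lemma line_derivatives:
  assumes "t \<le> 0"
  obtains g where "\<forall>\<^sub>F s in nhds 0. ((\<lambda>s. u (t, y + s *\<^sub>R x)) has_real_derivative g s) (at s)"
    and "g 0 = a 0 1 x" "(g has_real_derivative 2 * a 0 2 x) (at 0)"
proof
  define c where "c n = a 0 n x" for n
  have "\<forall>\<^sub>F s in nhds 0. (\<lambda>n. c n * s ^ n) sums u (t, y + s *\<^sub>R x)"
    using eventually_space_expansion[of 0 x] assms radius_pos
    by (simp add: space_coeff_time_0 c_def)
  then obtain r where "0 < r"
    and line: "\<And>s. \<bar>s\<bar> < r \<Longrightarrow> (\<lambda>n. c n * s ^ n) sums u (t, y + s *\<^sub>R x)"
    by (auto simp: eventually_nhds_metric dist_real_def)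
  then have summable: "summable (\<lambda>n. c n * s ^ n)" if "norm s < r" for s
    using that sums_summable by auto
  show "\<forall>\<^sub>F s in nhds 0.
      ((\<lambda>s. u (t, y + s *\<^sub>R x)) has_real_derivative (\<Sum>n. diffs c n * s ^ n)) (at s)"
    using eventually_norm_less[OF \<open>0 < r\<close>]
  proof eventually_elim
    case (elim s)
    show ?case
    proof (rule has_field_derivative_transform_within_open[OF termdiffs_strong'[OF summable elim]])
      show "(\<Sum>n. c n * s ^ n) = u (t, y + s *\<^sub>R x)" if "s \<in> ball 0 r" for s
        using line[of s] that by (simp add: sums_iff)
    qed (use elim in auto)
  qed
  show "(\<Sum>n. diffs c n * 0 ^ n) = a 0 1 x" by (simp add: powser_zero diffs_def c_def)
  have "((\<lambda>s. \<Sum>n. diffs c n * s ^ n) has_real_derivative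
      (\<Sum>n. diffs (diffs c) n * 0 ^ n)) (at 0)"
    using termdiff_converges[OF _ summable] \<open>0 < r\<close> by (intro termdiffs_strong') auto
  then show "((\<lambda>s. \<Sum>n. diffs c n * s ^ n) has_real_derivative 2 * a 0 2 x) (at 0)"
    by (simp add: powser_zero diffs_def c_def numeral_2_eq_2)
qed

end

definition time_deriv :: "(real \<times> 'a \<Rightarrow> real) \<Rightarrow> real \<times> 'a \<Rightarrow> real" where
  "time_deriv u = (\<lambda>(t, x). vector_derivative (\<lambda>s. u (s, x)) (at t within {..0}))"

lemma time_derivI:
  assumes "((\<lambda>s. u (s, x)) has_real_derivative d) (at t within {..0})" "t \<le> 0"
  shows "time_deriv u (t, x) = d"
proof -
  have "at_left t \<le> at t within {..0}" using assms(2) by (intro at_le) auto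
  then have "at t within {..0} \<noteq> bot"
    using trivial_limit_at_left_real[of t] by (auto simp: bot_unique)
  then show ?thesis
    using assms(1)
    by (simp add: time_deriv_def vector_derivative_within
        has_real_derivative_iff_has_vector_derivative)
qed

lemma (in jet) has_time_derivative:
  assumes "\<bar>\<tau>\<bar> < \<rho>" "norm x \<le> \<rho>" "t + \<tau> \<le> 0"
  shows "((\<lambda>s. u (s, y + x)) has_real_derivative (\<Sum>k. diffs (time_coeff a x) k * \<tau> ^ k))
    (at (t + \<tau>) within {..0})"
proof -
  let ?series = "\<lambda>s. \<Sum>k. time_coeff a x k * s ^ k" and ?d = "\<Sum>k. diffs (time_coeff a x) k * \<tau> ^ k"
  have "summable (\<lambda>k. time_coeff a x k * \<rho> ^ k)"
    using has_sum_imp_sums[OF time_series_has_sum[of \<rho> x]] assms(2) radius_pos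
    by (auto intro: sums_summable)
  then have "(?series has_real_derivative ?d) (at \<tau>)"
    by (rule termdiffs_strong) (use assms(1) in simp)
  then have "((\<lambda>s. ?series (s - t)) has_real_derivative ?d) (at (t + \<tau>))"
    using DERIV_shift[of "\<lambda>s. ?series (s - t)" _ \<tau> t] by (simp add: add.commute)
  from has_field_derivative_at_within[OF this]
  show ?thesis
  proof (rule has_field_derivative_transform_within)
    show "0 < \<rho> - \<bar>\<tau>\<bar>" using assms(1) by simp
    fix s assume "s \<in> {..0}" "dist s (t + \<tau>) < \<rho> - \<bar>\<tau>\<bar>"
    then show "?series (s - t) = u (s, y + x)"
      using time_expansion[of "s - t" x] assms by (simp add: dist_real_def sums_iff)
  qed (use assms in simp)
qed

lemma (in jet) jet_time_deriv:
  "jet (time_deriv u) t y (\<rho> / 2) (time_deriv_coeff a) (time_deriv_majorant A)"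
proof (intro jet.intro jet_axioms.intro time_deriv_coefficients)
  interpret deriv: jet_coefficients "\<rho> / 2" "time_deriv_coeff a" "time_deriv_majorant A"
    by (rule time_deriv_coefficients)
  fix \<tau> :: real and x :: "real^'n"
  assume small: "\<bar>\<tau>\<bar> \<le> \<rho> / 2" "norm x \<le> \<rho> / 2" "t + \<tau> \<le> 0"
  have "time_coeff (time_deriv_coeff a) x = diffs (time_coeff a x)"
    by (simp add: fun_eq_iff time_coeff_def diffs_def time_deriv_coeff_def infsum_cmult_right')
  with has_sum_imp_sums[OF deriv.time_series_has_sum[OF small(1,2)]]
  have "(\<lambda>k. diffs (time_coeff a x) k * \<tau> ^ k) sums (\<Sum>\<^sub>\<infinity>(k, n). time_deriv_coeff a k n x * \<tau> ^ k)"
    by simp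
  moreover have "time_deriv u (t + \<tau>, y + x) = (\<Sum>k. diffs (time_coeff a x) k * \<tau> ^ k)"
    using small radius_pos by (intro time_derivI has_time_derivative) auto
  ultimately show "((\<lambda>(k, n). time_deriv_coeff a k n x * \<tau> ^ k) has_sum
      time_deriv u (t + \<tau>, y + x)) UNIV"
    using has_sum_infsum[OF deriv.series_summable[OF small(1,2)]] by (simp add: sums_iff)
qed

lemma (in jet) time_deriv_center: "t \<le> 0 \<Longrightarrow> time_deriv u (t, y) = a 1 0 0"
  using jet.center_value[OF jet_time_deriv] by (simp add: time_deriv_coeff_def)

subsection \<open>Analytic functions have jets\<close>

definition monomial :: "('n \<Rightarrow> nat) \<Rightarrow> real^'n \<Rightarrow> real" where
  "monomial \<alpha> x = (\<Prod>i\<in>UNIV. x $ i ^ \<alpha> i)"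

lemma monomial_scaleR: "monomial \<alpha> (s *\<^sub>R x) = s ^ sum \<alpha> UNIV * monomial \<alpha> x"
  by (simp add: monomial_def power_mult_distrib prod.distrib power_sum)

lemma abs_monomial_le: "\<bar>monomial \<alpha> x\<bar> \<le> norm x ^ sum \<alpha> UNIV"
proof -
  have "(\<Prod>i\<in>UNIV. \<bar>x $ i\<bar> ^ \<alpha> i) \<le> (\<Prod>i\<in>UNIV. norm x ^ \<alpha> i)"
    by (intro prod_mono) (auto intro!: power_mono component_le_norm_cart)
  then show ?thesis by (simp add: monomial_def abs_prod power_abs power_sum)
qed

lemma monomial_degree_Suc:
  fixes \<alpha> :: "'n::finite \<Rightarrow> nat"
  assumes "sum \<alpha> UNIV = Suc n"
  obtains i \<beta> where "sum \<beta> UNIV = n" "monomial \<alpha> = (\<lambda>x. x $ i * monomial \<beta> x)"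
proof -
  have "\<exists>i. \<alpha> i \<noteq> 0" using assms by (metis sum.neutral nat.distinct(1))
  then obtain i where nonzero: "\<alpha> i \<noteq> 0" by blast
  define \<beta> where "\<beta> j = (if j = i then \<alpha> i - 1 else \<alpha> j)" for j
  have "\<alpha> j = (if j = i then 1 else 0) + \<beta> j" for j
    using nonzero by (simp add: \<beta>_def)
  then have "sum \<alpha> UNIV = (\<Sum>j\<in>UNIV. (if j = i then 1 else 0) + \<beta> j)" by metis
  then have "sum \<beta> UNIV = n" using assms by (simp add: sum.distrib)
  moreover have "monomial \<alpha> x = x $ i * monomial \<beta> x" for x
  proof -
    have "x $ j ^ \<alpha> j = (if j = i then x $ i else 1) * x $ j ^ \<beta> j" for j
      using nonzero by (cases "\<alpha> i") (auto simp: \<beta>_def)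
    then show ?thesis by (simp add: monomial_def prod.distrib)
  qed
  ultimately show ?thesis using that by blast
qed

lemma linear_monomial:
  fixes \<alpha> :: "'n::finite \<Rightarrow> nat"
  assumes "sum \<alpha> UNIV = 1"
  shows "linear (monomial \<alpha>)"
proof -
  obtain i \<beta> where "sum \<beta> UNIV = 0" "monomial \<alpha> = (\<lambda>x. x $ i * monomial \<beta> x)"
    by (rule monomial_degree_Suc[of \<alpha> 0]) (use assms in simp, blast)
  then have "monomial \<alpha> = (\<lambda>x. x $ i)" by (simp add: monomial_def)
  then show ?thesis by (simp add: bounded_linear.linear bounded_linear_vec_nth)
qed

lemma quadratic_form_monomial:
  fixes \<alpha> :: "'n::finite \<Rightarrow> nat"
  assumes "sum \<alpha> UNIV = 2"
  shows "quadratic_form (monomial \<alpha>)"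
proof -
  obtain i \<beta> where degree: "sum \<beta> UNIV = 1" and split: "monomial \<alpha> = (\<lambda>x. x $ i * monomial \<beta> x)"
    by (rule monomial_degree_Suc[of \<alpha> 1]) (use assms in simp, blast)
  show ?thesis
    unfolding split
    by (intro quadratic_form_mult linear_monomial[OF degree] bounded_linear.linear
        bounded_linear_vec_nth)
qed

definition degree_part :: "(nat \<times> ('n \<Rightarrow> nat) \<Rightarrow> real) \<Rightarrow> nat \<Rightarrow> nat \<Rightarrow> real^'n \<Rightarrow> real" where
  "degree_part c k n x = (\<Sum>\<alpha> | sum \<alpha> UNIV = n. c (k, \<alpha>) * monomial \<alpha> x)"

lemma finite_multiindices_of_degree: "finite {\<alpha> :: 'n::finite \<Rightarrow> nat. sum \<alpha> UNIV = n}"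
proof (rule finite_subset)
  show "{\<alpha> :: 'n \<Rightarrow> nat. sum \<alpha> UNIV = n} \<subseteq> PiE UNIV (\<lambda>_. {..n})"
    by (auto intro: member_le_sum)
qed (intro finite_PiE; simp)

lemma has_sum_by_degree:
  fixes f :: "nat \<times> ('n::finite \<Rightarrow> nat) \<Rightarrow> real"
  assumes "(f has_sum v) UNIV"
  shows "((\<lambda>(k, n). \<Sum>\<alpha> | sum \<alpha> UNIV = n. f (k, \<alpha>)) has_sum v) UNIV"
proof -
  let ?S = "Sigma UNIV (\<lambda>(k :: nat, n). {\<alpha> :: 'n \<Rightarrow> nat. sum \<alpha> UNIV = n})"
  have "(f has_sum v) UNIV \<longleftrightarrow> ((\<lambda>(p, \<alpha>). f (fst p, \<alpha>)) has_sum v) ?S"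
    by (rule has_sum_reindex_bij_witness[where i = "\<lambda>(p, \<alpha>). (fst p, \<alpha>)"
          and j = "\<lambda>(k, \<alpha>). ((k, sum \<alpha> UNIV), \<alpha>)"]) auto
  with assms have "((\<lambda>(p, \<alpha>). f (fst p, \<alpha>)) has_sum v) ?S" by simp
  then show ?thesis
    by (rule has_sum_SigmaD) (auto intro!: has_sum_finiteI finite_multiindices_of_degree)
qed

lemma jet_coefficients_degree_part:
  fixes c :: "nat \<times> ('n::finite \<Rightarrow> nat) \<Rightarrow> real"
  assumes "0 < \<rho>" "(\<lambda>(k, \<alpha>). c (k, \<alpha>) * \<rho> ^ (k + sum \<alpha> UNIV)) summable_on UNIV"
  shows "jet_coefficients \<rho> (degree_part c) (\<lambda>k n. \<Sum>\<alpha> | sum \<alpha> UNIV = n. \<bar>c (k, \<alpha>)\<bar>)"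
proof (rule jet_coefficients.intro)
  let ?f = "\<lambda>(k, \<alpha>). c (k, \<alpha>) * \<rho> ^ (k + sum \<alpha> UNIV)"
  obtain v where "((\<lambda>q. norm (?f q)) has_sum v) UNIV"
    using assms(2)[unfolded summable_on_iff_abs_summable_on_real[of ?f]]
    by (auto simp: summable_on_def)
  from has_sum_by_degree[OF this]
  show "(\<lambda>(k, n). (\<Sum>\<alpha> | sum \<alpha> UNIV = n. \<bar>c (k, \<alpha>)\<bar>) * \<rho> ^ (k + n)) summable_on UNIV"
    using assms(1) by (auto simp: summable_on_def abs_mult sum_distrib_right)
  show "\<bar>degree_part c k n x\<bar> \<le> (\<Sum>\<alpha> | sum \<alpha> UNIV = n. \<bar>c (k, \<alpha>)\<bar>) * norm x ^ n" for k n x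
    unfolding degree_part_def sum_distrib_right
    by (rule order_trans[OF sum_abs sum_mono])
       (auto simp: abs_mult intro!: mult_left_mono abs_monomial_le)
  show "degree_part c k n (s *\<^sub>R x) = s ^ n * degree_part c k n x" for k n s x
    unfolding degree_part_def sum_distrib_left by (intro sum.cong) (auto simp: monomial_scaleR)
  show "linear (degree_part c k 1)" for k
    unfolding degree_part_def[abs_def]
    by (intro linear_compose_sum ballI linear_cmult linear_monomial) auto
  show "quadratic_form (degree_part c k 2)" for k
    unfolding degree_part_def[abs_def]
    by (intro quadratic_form_sum quadratic_form_cmult quadratic_form_monomial) auto
qed (rule assms(1))

lemma real_analytic_imp_jet:
  fixes g :: "real \<times> (real^'n) \<Rightarrow> real"
  assumes "real_analytic_at g (t, y)"
  shows "\<exists>\<rho> a A. jet g t y \<rho> a A"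
proof -
  obtain r c where "r > 0" and power_series: "\<And>q. dist q (t, y) < r \<Longrightarrow>
     ((\<lambda>(k, \<alpha>). c (k, \<alpha>) * (fst q - t) ^ k * monomial \<alpha> (snd q - y)) has_sum g q) UNIV"
    using assms
    unfolding real_analytic_at_def monomial_def vector_minus_component fst_conv snd_conv by blast
  define N where "N = 1 + real CARD('n)"
  define \<rho> where "\<rho> = r / (2 * N)"
  have "N \<ge> 2" by (simp add: N_def Suc_leI)
  then have "\<rho> > 0" "N * \<rho> = r / 2" using \<open>r > 0\<close> by (simp_all add: \<rho>_def)
  then have \<rho>: "\<rho> > 0" "N * \<rho> < r" "2 * \<rho> \<le> N * \<rho>" using \<open>r > 0\<close> \<open>N \<ge> 2\<close> by auto
  have series: "((\<lambda>(k, \<alpha>). c (k, \<alpha>) * \<tau> ^ k * monomial \<alpha> x) has_sum g (t + \<tau>, y + x)) UNIV"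
    if "\<bar>\<tau>\<bar> + norm x < r" for \<tau> and x :: "real^'n"
    using power_series[of "(t + \<tau>, y + x)"] norm_Pair_le[of \<tau> x] that by (simp add: dist_norm)
  have "\<bar>\<rho>\<bar> + norm (vec \<rho> :: real^'n) \<le> N * \<rho>"
    using norm_le_l1_cart[of "vec \<rho> :: real^'n"] \<rho>(1) by (simp add: N_def algebra_simps)
  from series[of \<rho> "vec \<rho>"] this have "(\<lambda>(k, \<alpha>). c (k, \<alpha>) * \<rho> ^ (k + sum \<alpha> UNIV)) summable_on UNIV"
    using \<rho> by (auto simp: summable_on_def monomial_def power_add power_sum mult.assoc)
  from jet_coefficients_degree_part[OF \<rho>(1) this]
  have "jet g t y \<rho> (degree_part c) (\<lambda>k n. \<Sum>\<alpha> | sum \<alpha> UNIV = n. \<bar>c (k, \<alpha>)\<bar>)"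
  proof (intro jet.intro jet_axioms.intro)
    fix \<tau> :: real and x :: "real^'n"
    assume "\<bar>\<tau>\<bar> \<le> \<rho>" "norm x \<le> \<rho>"
    then have "\<bar>\<tau>\<bar> + norm x < r" using \<rho> by linarith
    from has_sum_by_degree[OF series[OF this]]
    show "((\<lambda>(k, n). degree_part c k n x * \<tau> ^ k) has_sum g (t + \<tau>, y + x)) UNIV"
      by (simp add: degree_part_def sum_distrib_left sum_distrib_right mult_ac)
  qed
  then show ?thesis by blast
qed

subsection \<open>The classical equation\<close>

definition solves_at ::
  "(real^'n^'n \<Rightarrow> real) \<Rightarrow> (real \<times> (real^'n) \<Rightarrow> real) \<Rightarrow> real \<Rightarrow> real^'n \<Rightarrow> bool" where
  "solves_at F u t y \<longleftrightarrow> (\<exists>\<rho> a A. jet u t y \<rho> a A \<and> a 1 0 0 = F (form_hessian (a 0 2)))"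

lemma (in jet) solves_at_iff:
  assumes "t \<le> 0"
  shows "solves_at F u t y \<longleftrightarrow> a 1 0 0 = F (form_hessian (a 0 2))"
  using jet_unique[OF jet_axioms _ assms] jet_axioms unfolding solves_at_def by metis

lemma (in jet) solves_at_time_shift:
  assumes "solves_at F u (t + \<tau>) y" "\<bar>\<tau>\<bar> \<le> \<rho>" "t + \<tau> \<le> 0"
  shows "quadratic_form (space_coeff a \<tau> 2)"
    and "time_deriv u (t + \<tau>, y) = F (form_hessian (space_coeff a \<tau> 2))"
proof -
  obtain r b B where "jet u (t + \<tau>) y r b B" and equation: "b 1 0 0 = F (form_hessian (b 0 2))"
    using assms(1) by (auto simp: solves_at_def)
  then interpret b: jet u "t + \<tau>" y r b B by simp
  have "space_coeff a \<tau> 2 = b 0 2"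
    by (rule ext, rule space_coeff_eq_shifted_center[OF b.jet_axioms assms(2,3)])
  then show "quadratic_form (space_coeff a \<tau> 2)"
    and "time_deriv u (t + \<tau>, y) = F (form_hessian (space_coeff a \<tau> 2))"
    using b.quadratic_coeff b.time_deriv_center[OF assms(3)] equation by auto
qed

lemma continuous_on_quadratic_form:
  assumes "quadratic_form q"
  shows "continuous_on S q"
proof -
  have "continuous_on S (\<lambda>x. x \<bullet> (form_hessian q *v x) / 2)"
    by (intro continuous_intros bounded_linear.continuous_on[OF matrix_vector_mul_bounded_linear])
       simp
  then show ?thesis by (simp add: inner_form_hessian[OF assms])
qed

definition paraboloid ::
  "real \<times> (real^'n) \<Rightarrow> real \<Rightarrow> real \<Rightarrow> real \<Rightarrow> (real^'n \<Rightarrow> real) \<Rightarrow> (real^'n \<Rightarrow> real)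
    \<Rightarrow> real \<times> (real^'n) \<Rightarrow> real" where
  "paraboloid p c d C l q =
     (\<lambda>(s, x). c + d * (s - fst p) + C * (s - fst p)\<^sup>2 + l (x - snd p) + q (x - snd p))"

lemma C12_test_paraboloid:
  fixes l q :: "real^'n \<Rightarrow> real"
  assumes "linear l" "quadratic_form q"
  shows "C12_test (paraboloid p c d C l q)
    (\<lambda>(s, x). d + 2 * C * (s - fst p)) (\<lambda>i j _. form_hessian q $ i $ j)"
proof -
  let ?H = "form_hessian q" and ?t = "fst p" and ?y = "snd p"
  let ?P = "\<lambda>s x. c + d * (s - ?t) + C * (s - ?t)\<^sup>2 + l (x - ?y) + q (x - ?y)"
  define g where "g i = (\<lambda>(s :: real, x). l (axis i 1) + (?H *v (x - ?y)) $ i)" for i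
  note [continuous_intros] =
    bounded_linear.continuous_on[OF matrix_vector_mul_bounded_linear]
    bounded_linear.continuous_on[OF assms(1)[unfolded linear_conv_bounded_linear]]
    continuous_on_compose2[OF continuous_on_quadratic_form[OF assms(2), of UNIV]]
  have shift: "x + s *\<^sub>R e - ?y = (x - ?y) + s *\<^sub>R e" for x e :: "real^'n" and s by simp
  show ?thesis
    unfolding C12_test_def paraboloid_def
  proof (intro exI[of _ g] conjI allI)
    fix s :: real and x :: "real^'n" and i j
    show "((\<lambda>h. case (s + h, x) of (s, x) \<Rightarrow> ?P s x)
        has_real_derivative (case (s, x) of (s, x) \<Rightarrow> d + 2 * C * (s - ?t))) (at 0)"
      by (auto intro!: derivative_eq_intros)
    show "((\<lambda>h. case (s, x + h *\<^sub>R axis i 1) of (s, x) \<Rightarrow> ?P s x)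
        has_real_derivative g i (s, x)) (at 0)"
      unfolding prod.case shift linear_add[OF assms(1)] linear_scale[OF assms(1)]
        quadratic_form_expand[OF assms(2)] quadratic_form_scaleR[OF assms(2)]
      by (auto intro!: derivative_eq_intros simp: g_def inner_axis)
    show "((\<lambda>h. g i (s, x + h *\<^sub>R axis j 1)) has_real_derivative ?H $ i $ j) (at 0)"
      unfolding g_def prod.case shift matrix_vector_right_distrib matrix_vector_mult_scaleR
      by (auto intro!: derivative_eq_intros simp: matrix_vector_mult_basis column_def)
  qed (auto simp: case_prod_unfold g_def intro!: continuous_intros)
qed

lemma parabolic_remainder_le_quadratic:
  assumes "0 \<le> M" "0 < \<epsilon>" "0 \<le> r" "M * r \<le> \<epsilon> / 2"
  shows "M * parabolic_remainder \<bar>\<tau>\<bar> r \<le> (M + M\<^sup>2 / (2 * \<epsilon>)) * \<tau>\<^sup>2 + \<epsilon> * r\<^sup>2"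
proof -
  have "0 \<le> (M * \<bar>\<tau>\<bar> - \<epsilon> * r)\<^sup>2 / (2 * \<epsilon>)" using assms by simp
  also have "\<dots> = M\<^sup>2 / (2 * \<epsilon>) * \<tau>\<^sup>2 - M * (\<bar>\<tau>\<bar> * r) + \<epsilon> / 2 * r\<^sup>2"
    using assms by (simp add: power2_diff power_mult_distrib field_simps power2_eq_square)
  finally have mixed: "M * (\<bar>\<tau>\<bar> * r) \<le> M\<^sup>2 / (2 * \<epsilon>) * \<tau>\<^sup>2 + \<epsilon> / 2 * r\<^sup>2" by simp
  have "M * r * r\<^sup>2 \<le> \<epsilon> / 2 * r\<^sup>2" using assms by (intro mult_right_mono) auto
  then have cubic: "M * r ^ 3 \<le> \<epsilon> / 2 * r\<^sup>2"
    by (simp add: power3_eq_cube power2_eq_square mult.assoc)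
  show ?thesis using mixed cubic by (simp add: parabolic_remainder_def algebra_simps)
qed

context jet
begin

lemma eventually_near_taylor_polynomial:
  assumes "0 < \<epsilon>"
  shows "\<exists>C. \<forall>\<^sub>F (s, x) in nhds (t, y). s \<le> 0 \<longrightarrow>
    \<bar>u (s, x) - taylor_polynomial a (s - t) (x - y)\<bar> \<le> C * (s - t)\<^sup>2 + \<epsilon> * (norm (x - y))\<^sup>2"
proof -
  obtain M where "0 \<le> M" and taylor: "\<And>\<tau> x. \<bar>\<tau>\<bar> \<le> \<rho> \<Longrightarrow> norm x \<le> \<rho> \<Longrightarrow> t + \<tau> \<le> 0 \<Longrightarrow>
     \<bar>u (t + \<tau>, y + x) - taylor_polynomial a \<tau> x\<bar> \<le> M * parabolic_remainder \<bar>\<tau>\<bar> (norm x)"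
    using parabolic_taylor by blast
  let ?C = "M + M\<^sup>2 / (2 * \<epsilon>)" and ?r = "min \<rho> (\<epsilon> / 2 / (M + 1))"
  have "\<bar>u (s, x) - taylor_polynomial a (s - t) (x - y)\<bar> \<le> ?C * (s - t)\<^sup>2 + \<epsilon> * (norm (x - y))\<^sup>2"
    if near: "dist (s, x) (t, y) < ?r" and "s \<le> 0" for s x
  proof -
    have "\<bar>s - t\<bar> \<le> dist (s, x) (t, y)" "norm (x - y) \<le> dist (s, x) (t, y)"
      using dist_fst_le[of "(s, x)" "(t, y)"] dist_snd_le[of "(s, x)" "(t, y)"]
      by (auto simp: dist_norm)
    then have small: "\<bar>s - t\<bar> \<le> \<rho>" "norm (x - y) \<le> \<rho>" "norm (x - y) \<le> \<epsilon> / 2 / (M + 1)"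
      using near by auto
    have "M * norm (x - y) \<le> (M + 1) * (\<epsilon> / 2 / (M + 1))"
      using small(3) \<open>0 \<le> M\<close> by (intro mult_mono) auto
    also have "\<dots> = \<epsilon> / 2" using \<open>0 \<le> M\<close> by (simp add: field_simps)
    finally have "M * parabolic_remainder \<bar>s - t\<bar> (norm (x - y))
        \<le> ?C * (s - t)\<^sup>2 + \<epsilon> * (norm (x - y))\<^sup>2"
      by (intro parabolic_remainder_le_quadratic \<open>0 \<le> M\<close> assms) auto
    with taylor[OF small(1,2)] \<open>s \<le> 0\<close> show ?thesis by simp
  qed
  moreover have "0 < ?r" using radius_pos assms \<open>0 \<le> M\<close> by simp
  ultimately show ?thesis
    unfolding eventually_nhds_metric by (intro exI[of _ ?C] exI[of _ ?r]) auto
qed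

definition perturbed_form :: "real \<Rightarrow> real^'n \<Rightarrow> real" where
  "perturbed_form \<epsilon> x = a 0 2 x + \<epsilon> * (norm x)\<^sup>2"

definition perturbed_paraboloid :: "real \<Rightarrow> real \<Rightarrow> real \<times> (real^'n) \<Rightarrow> real" where
  "perturbed_paraboloid C \<epsilon> =
    paraboloid (t, y) (a 0 0 0) (a 1 0 0) C (a 0 1) (perturbed_form \<epsilon>)"

lemma quadratic_form_perturbed_form: "quadratic_form (perturbed_form \<epsilon>)"
  unfolding perturbed_form_def[abs_def]
  by (intro quadratic_form_add quadratic_form_cmult quadratic_form_norm_power2 quadratic_coeff)

lemma C12_test_perturbed_paraboloid:
  "C12_test (perturbed_paraboloid C \<epsilon>) (\<lambda>(s, x). a 1 0 0 + 2 * C * (s - fst (t, y)))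
    (\<lambda>i j _. form_hessian (perturbed_form \<epsilon>) $ i $ j)"
  unfolding perturbed_paraboloid_def
  by (intro C12_test_paraboloid linear_coeff quadratic_form_perturbed_form)

lemma perturbed_paraboloid_center: "t \<le> 0 \<Longrightarrow> perturbed_paraboloid C \<epsilon> (t, y) = u (t, y)"
  using coeff_at_0[of 1 0] coeff_at_0[of 2 0]
  by (simp add: perturbed_paraboloid_def perturbed_form_def paraboloid_def center_value)

lemma eventually_between_paraboloids:
  assumes "0 < \<epsilon>"
  shows "\<exists>C. \<forall>\<^sub>F p in nhds (t, y). fst p \<le> 0 \<longrightarrow>
    perturbed_paraboloid (- C) (- \<epsilon>) p \<le> u p \<and> u p \<le> perturbed_paraboloid C \<epsilon> p"
proof -
  obtain C where "\<forall>\<^sub>F (s, x) in nhds (t, y). s \<le> 0 \<longrightarrow>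
    \<bar>u (s, x) - taylor_polynomial a (s - t) (x - y)\<bar> \<le> C * (s - t)\<^sup>2 + \<epsilon> * (norm (x - y))\<^sup>2"
    using eventually_near_taylor_polynomial[OF assms] by blast
  then have "\<forall>\<^sub>F p in nhds (t, y). fst p \<le> 0 \<longrightarrow>
      perturbed_paraboloid (- C) (- \<epsilon>) p \<le> u p \<and> u p \<le> perturbed_paraboloid C \<epsilon> p"
    by eventually_elim
      (auto simp: perturbed_paraboloid_def perturbed_form_def paraboloid_def taylor_polynomial_def
        abs_le_iff algebra_simps)
  then show ?thesis ..
qed

end

lemma viscosity_subsolution_test:
  assumes "viscosity_subsolution F Q u" "p \<in> Q" "C12_test \<phi> \<phi>t h"
    and "\<forall>\<^sub>F q in nhds p. q \<in> Q \<longrightarrow> u q - \<phi> q \<le> u p - \<phi> p"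
  shows "\<phi>t p \<le> F (hess_mat h p)"
proof -
  have "\<exists>r>0. \<forall>q\<in>Q. dist q p < r \<longrightarrow> u q - \<phi> q \<le> u p - \<phi> p"
    using assms(4) unfolding eventually_nhds_metric by blast
  then have "\<phi>t p - F (hess_mat h p) \<le> 0"
    using assms(1-3) unfolding viscosity_subsolution_def by blast
  then show ?thesis by simp
qed

lemma viscosity_supersolution_test:
  assumes "viscosity_supersolution F Q u" "p \<in> Q" "C12_test \<phi> \<phi>t h"
    and "\<forall>\<^sub>F q in nhds p. q \<in> Q \<longrightarrow> u q - \<phi> q \<ge> u p - \<phi> p"
  shows "F (hess_mat h p) \<le> \<phi>t p"
proof -
  have "\<exists>r>0. \<forall>q\<in>Q. dist q p < r \<longrightarrow> u q - \<phi> q \<ge> u p - \<phi> p"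
    using assms(4) unfolding eventually_nhds_metric by blast
  then have "\<phi>t p - F (hess_mat h p) \<ge> 0"
    using assms(1-3) unfolding viscosity_supersolution_def by blast
  then show ?thesis by simp
qed

lemma (in jet) viscosity_solution_time_coeff_bounds:
  assumes "viscosity_solution F Q u" "(t, y) \<in> Q" "Q \<subseteq> {..0} \<times> UNIV" "0 < \<epsilon>"
  shows "a 1 0 0 \<le> F (form_hessian (perturbed_form \<epsilon>))"
    and "F (form_hessian (perturbed_form (- \<epsilon>))) \<le> a 1 0 0"
proof -
  have "t \<le> 0" using assms(2,3) by auto
  note center = perturbed_paraboloid_center[OF this]
  obtain C where "\<forall>\<^sub>F p in nhds (t, y). fst p \<le> 0 \<longrightarrow>
      perturbed_paraboloid (- C) (- \<epsilon>) p \<le> u p \<and> u p \<le> perturbed_paraboloid C \<epsilon> p"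
    using eventually_between_paraboloids[OF assms(4)] by blast
  then have between: "\<forall>\<^sub>F p in nhds (t, y). p \<in> Q \<longrightarrow>
      perturbed_paraboloid (- C) (- \<epsilon>) p \<le> u p \<and> u p \<le> perturbed_paraboloid C \<epsilon> p"
    by eventually_elim (use assms(3) in auto)
  have hess_mat: "hess_mat (\<lambda>i j _. H $ i $ j) p = H" for H :: "real^'n^'n" and p
    by (simp add: hess_mat_def)
  have "\<forall>\<^sub>F p in nhds (t, y). p \<in> Q \<longrightarrow>
      u p - perturbed_paraboloid C \<epsilon> p \<le> u (t, y) - perturbed_paraboloid C \<epsilon> (t, y)"
    using between by eventually_elim (simp add: center)
  from viscosity_subsolution_test[OF _ assms(2) C12_test_perturbed_paraboloid this, of F]
  show "a 1 0 0 \<le> F (form_hessian (perturbed_form \<epsilon>))"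
    using assms(1) by (simp add: viscosity_solution_def hess_mat)
  have "\<forall>\<^sub>F p in nhds (t, y). p \<in> Q \<longrightarrow>
      u p - perturbed_paraboloid (- C) (- \<epsilon>) p \<ge> u (t, y) - perturbed_paraboloid (- C) (- \<epsilon>) (t, y)"
    using between by eventually_elim (simp add: center)
  from viscosity_supersolution_test[OF _ assms(2) C12_test_perturbed_paraboloid this, of F]
  show "F (form_hessian (perturbed_form (- \<epsilon>))) \<le> a 1 0 0"
    using assms(1) by (simp add: viscosity_solution_def hess_mat)
qed

lemma (in elliptic_operator) viscosity_solution_solves_at:
  assumes "viscosity_solution F Q u" "(t, y) \<in> Q" "Q \<subseteq> {..0} \<times> UNIV" "jet u t y \<rho> a A"
  shows "solves_at F u t y"
proof -
  interpret jet u t y \<rho> a A by fact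
  let ?K = "2 * Lam * CARD('n)"
  have "\<bar>a 1 0 0 - F (form_hessian (a 0 2))\<bar> \<le> ?K * \<epsilon>" if "0 < \<epsilon>" for \<epsilon>
  proof -
    have "\<bar>F (form_hessian (perturbed_form \<sigma>)) - F (form_hessian (a 0 2))\<bar> \<le> ?K * \<epsilon>"
      if "\<bar>\<sigma>\<bar> = \<epsilon>" for \<sigma>
      by (rule F_lipschitz[OF quadratic_form_perturbed_form quadratic_coeff])
         (use that \<open>0 < \<epsilon>\<close> in \<open>auto simp: perturbed_form_def abs_mult\<close>)
    from this[of \<epsilon>] this[of "- \<epsilon>"] show ?thesis
      using viscosity_solution_time_coeff_bounds[OF assms(1-3) that] that by (simp add: abs_le_iff)
  qed
  then have "\<forall>\<^sub>F \<epsilon> in at_right 0. \<bar>a 1 0 0 - F (form_hessian (a 0 2))\<bar> \<le> ?K * \<bar>\<epsilon>\<bar>"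
    by (simp add: eventually_at_filter)
  from nonpos_if_eventually_le_abs[OF _ at_le this] show ?thesis
    using jet_axioms by (auto simp: solves_at_def)
qed

subsection \<open>Uniqueness for the terminal value problem\<close>

lemma space_coeff_close:
  assumes "jet_coefficients \<rho> a A" "jet_coefficients r b B" "\<And>k x. k < K \<Longrightarrow> a k n x = b k n x"
  obtains C where "0 \<le> C" "\<And>\<tau> x. \<bar>\<tau>\<bar> \<le> \<rho> \<Longrightarrow> \<bar>\<tau>\<bar> \<le> r \<Longrightarrow>
      \<bar>space_coeff a \<tau> n x - space_coeff b \<tau> n x\<bar> \<le> C * \<bar>\<tau>\<bar> ^ K * norm x ^ n"
proof -
  obtain C\<^sub>a C\<^sub>b where "0 \<le> C\<^sub>a" "0 \<le> C\<^sub>b"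
    and taylor_a: "\<And>\<tau> x. \<bar>\<tau>\<bar> \<le> \<rho> \<Longrightarrow>
      \<bar>space_coeff a \<tau> n x - (\<Sum>k<K. a k n x * \<tau> ^ k)\<bar> \<le> C\<^sub>a * \<bar>\<tau>\<bar> ^ K * norm x ^ n"
    and taylor_b: "\<And>\<tau> x. \<bar>\<tau>\<bar> \<le> r \<Longrightarrow>
      \<bar>space_coeff b \<tau> n x - (\<Sum>k<K. b k n x * \<tau> ^ k)\<bar> \<le> C\<^sub>b * \<bar>\<tau>\<bar> ^ K * norm x ^ n"
    using jet_coefficients.space_coeff_taylor[OF assms(1), of n K]
      jet_coefficients.space_coeff_taylor[OF assms(2), of n K] by blast
  show thesis
  proof
    show "0 \<le> C\<^sub>a + C\<^sub>b" using \<open>0 \<le> C\<^sub>a\<close> \<open>0 \<le> C\<^sub>b\<close> by simp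
    fix \<tau> x assume "\<bar>\<tau>\<bar> \<le> \<rho>" "\<bar>\<tau>\<bar> \<le> r"
    moreover have "(\<Sum>k<K. a k n x * \<tau> ^ k) = (\<Sum>k<K. b k n x * \<tau> ^ k)" using assms(3) by simp
    ultimately show
      "\<bar>space_coeff a \<tau> n x - space_coeff b \<tau> n x\<bar> \<le> (C\<^sub>a + C\<^sub>b) * \<bar>\<tau>\<bar> ^ K * norm x ^ n"
      using taylor_a[of \<tau> x] taylor_b[of \<tau> x] unfolding distrib_right by linarith
  qed
qed

lemma jet_next_center_coeff_eqI:
  assumes "jet u t y \<rho> a A" "jet v t y r b B" "t \<le> 0"
    and lower: "\<And>k. k < m \<Longrightarrow> a k 0 0 = b k 0 0"
    and close: "\<forall>\<^sub>F \<tau> in at_left 0. \<bar>u (t + \<tau>, y) - v (t + \<tau>, y)\<bar> \<le> C * \<bar>\<tau>\<bar> ^ Suc m"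
  shows "a m 0 0 = b m 0 0"
proof -
  interpret u: jet u t y \<rho> a A by fact
  interpret v: jet v t y r b B by fact
  obtain C\<^sub>u C\<^sub>v where
    taylor_u: "\<And>\<tau>. \<bar>\<tau>\<bar> \<le> \<rho> \<Longrightarrow> t + \<tau> \<le> 0 \<Longrightarrow>
      \<bar>u (t + \<tau>, y) - (\<Sum>k<Suc m. a k 0 0 * \<tau> ^ k)\<bar> \<le> C\<^sub>u * \<bar>\<tau>\<bar> ^ Suc m"
    and taylor_v: "\<And>\<tau>. \<bar>\<tau>\<bar> \<le> r \<Longrightarrow> t + \<tau> \<le> 0 \<Longrightarrow>
      \<bar>v (t + \<tau>, y) - (\<Sum>k<Suc m. b k 0 0 * \<tau> ^ k)\<bar> \<le> C\<^sub>v * \<bar>\<tau>\<bar> ^ Suc m"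
    using u.center_taylor[of "Suc m"] v.center_taylor[of "Suc m"] by blast
  define d where "d = a m 0 0 - b m 0 0"
  have leading_term: "(\<Sum>k<Suc m. a k 0 0 * \<tau> ^ k) - (\<Sum>k<Suc m. b k 0 0 * \<tau> ^ k) = d * \<tau> ^ m" for \<tau>
    using lower by (simp add: d_def algebra_simps)
  have "\<forall>\<^sub>F \<tau> in at_left 0. - min \<rho> r < \<tau> \<and> \<tau> < 0"
    using u.radius_pos v.radius_pos
    by (auto simp: eventually_at_left_field intro!: exI[of _ "- min \<rho> r"])
  with close have "\<forall>\<^sub>F \<tau> in at_left 0. \<bar>d\<bar> \<le> (C + C\<^sub>u + C\<^sub>v) * \<bar>\<tau>\<bar>"
  proof eventually_elim
    case (elim \<tau>)
    then have "\<bar>\<tau>\<bar> \<le> \<rho>" "\<bar>\<tau>\<bar> \<le> r" "t + \<tau> \<le> 0" using assms(3) by auto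
    then have "\<bar>d * \<tau> ^ m\<bar> \<le> C * \<bar>\<tau>\<bar> ^ Suc m + C\<^sub>u * \<bar>\<tau>\<bar> ^ Suc m + C\<^sub>v * \<bar>\<tau>\<bar> ^ Suc m"
      using elim(1) taylor_u[of \<tau>] taylor_v[of \<tau>] unfolding leading_term[symmetric] by linarith
    then have "\<bar>d\<bar> * \<bar>\<tau>\<bar> ^ m \<le> (C + C\<^sub>u + C\<^sub>v) * \<bar>\<tau>\<bar> * \<bar>\<tau>\<bar> ^ m"
      by (simp add: abs_mult power_abs algebra_simps)
    then show ?case by (rule mult_right_le_imp_le) (use elim(2) in simp)
  qed
  from nonpos_if_eventually_le_abs[OF _ at_le this] show ?thesis by (simp add: d_def)
qed

lemma (in elliptic_operator) time_deriv_close: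
  assumes "jet u t y \<rho> a A" "jet v t y r b B" "t \<le> 0"
    and solves: "\<forall>\<^sub>F \<tau> in at_left 0. solves_at F u (t + \<tau>) y \<and> solves_at F v (t + \<tau>) y"
    and lower: "\<And>k x. k < K \<Longrightarrow> a k 2 x = b k 2 x"
  obtains C where "\<forall>\<^sub>F \<tau> in at_left 0.
    \<bar>time_deriv u (t + \<tau>, y) - time_deriv v (t + \<tau>, y)\<bar> \<le> C * \<bar>\<tau>\<bar> ^ K"
proof -
  interpret u: jet u t y \<rho> a A by fact
  interpret v: jet v t y r b B by fact
  obtain C where "0 \<le> C" and hessian_close: "\<And>\<tau> x. \<bar>\<tau>\<bar> \<le> \<rho> \<Longrightarrow> \<bar>\<tau>\<bar> \<le> r \<Longrightarrow>
      \<bar>space_coeff a \<tau> 2 x - space_coeff b \<tau> 2 x\<bar> \<le> C * \<bar>\<tau>\<bar> ^ K * (norm x)\<^sup>2"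
    using space_coeff_close[OF u.jet_coefficients_axioms v.jet_coefficients_axioms lower] by blast
  have "\<forall>\<^sub>F \<tau> in at_left 0. - min \<rho> r < \<tau> \<and> \<tau> < 0"
    using u.radius_pos v.radius_pos
    by (auto simp: eventually_at_left_field intro!: exI[of _ "- min \<rho> r"])
  with solves have "\<forall>\<^sub>F \<tau> in at_left 0.
      \<bar>time_deriv u (t + \<tau>, y) - time_deriv v (t + \<tau>, y)\<bar> \<le> 2 * Lam * CARD('n) * C * \<bar>\<tau>\<bar> ^ K"
  proof eventually_elim
    case (elim \<tau>)
    then have \<tau>: "\<bar>\<tau>\<bar> \<le> \<rho>" "\<bar>\<tau>\<bar> \<le> r" "t + \<tau> \<le> 0" using assms(3) by auto
    note shift_u = u.solves_at_time_shift[OF conjunct1[OF elim(1)] \<tau>(1,3)]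
    note shift_v = v.solves_at_time_shift[OF conjunct2[OF elim(1)] \<tau>(2,3)]
    have "\<bar>F (form_hessian (space_coeff a \<tau> 2)) - F (form_hessian (space_coeff b \<tau> 2))\<bar>
        \<le> 2 * Lam * CARD('n) * (C * \<bar>\<tau>\<bar> ^ K)"
      using \<open>0 \<le> C\<close> by (intro F_lipschitz shift_u(1) shift_v(1) hessian_close \<tau>(1,2)) simp
    then show ?case unfolding shift_u(2) shift_v(2) by (simp add: mult.assoc)
  qed
  then show thesis by (rule that)
qed

lemma (in elliptic_operator) next_time_coeff_unique:
  assumes "jet u t y \<rho> a A" "jet v t y r b B" "t \<le> 0"
    and solves: "\<forall>\<^sub>F \<tau> in at_left 0. solves_at F u (t + \<tau>) y \<and> solves_at F v (t + \<tau>) y"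
    and lower: "\<And>k n x. k \<le> m \<Longrightarrow> a k n x = b k n x"
  shows "a (Suc m) 0 0 = b (Suc m) 0 0"
proof -
  obtain C where "\<forall>\<^sub>F \<tau> in at_left 0.
      \<bar>time_deriv u (t + \<tau>, y) - time_deriv v (t + \<tau>, y)\<bar> \<le> C * \<bar>\<tau>\<bar> ^ Suc m"
    using time_deriv_close[OF assms(1-4), of "Suc m"] lower by auto
  from jet_next_center_coeff_eqI[OF jet.jet_time_deriv[OF assms(1)] jet.jet_time_deriv[OF assms(2)]
      assms(3) _ this]
  have "time_deriv_coeff a m 0 0 = time_deriv_coeff b m 0 0"
    using lower by (simp add: time_deriv_coeff_def)
  then show ?thesis by (simp add: time_deriv_coeff_def del: of_nat_Suc)
qed

lemma jet_coeff_eq_if_centers_eq: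
  assumes "jet u t y \<rho> a A" "jet v t y r b B" "t \<le> 0"
    and centers: "\<forall>\<^sub>F z in nhds y. \<exists>\<rho>' a' A' r' b' B'.
      jet u t z \<rho>' a' A' \<and> jet v t z r' b' B' \<and> a' k 0 0 = b' k 0 0"
  shows "a k n x = b k n x"
proof (rule jet_coeff_eqI[OF assms(1,2)])
  interpret u: jet u t y \<rho> a A by fact
  interpret v: jet v t y r b B by fact
  have "filterlim (\<lambda>x. y + x) (nhds (y + 0)) (nhds 0)" by (intro tendsto_intros filterlim_ident)
  from eventually_compose_filterlim[OF _ this] centers
  have "\<forall>\<^sub>F x in nhds 0. \<exists>\<rho>' a' A' r' b' B'.
      jet u t (y + x) \<rho>' a' A' \<and> jet v t (y + x) r' b' B' \<and> a' k 0 0 = b' k 0 0"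
    by simp
  with eventually_norm_less[OF u.radius_pos] eventually_norm_less[OF v.radius_pos]
  show "\<forall>\<^sub>F x in nhds 0. time_coeff a x k = time_coeff b x k"
  proof eventually_elim
    case (elim x)
    then show ?case
      using u.time_coeff_eq_shifted_center[OF _ _ assms(3), of x]
        v.time_coeff_eq_shifted_center[OF _ _ assms(3), of x] by force
  qed
qed

lemma (in elliptic_operator) time_coeffs_unique:
  assumes "open X" "T < 0"
    and solves_u: "\<And>t y. T < t \<Longrightarrow> t \<le> 0 \<Longrightarrow> y \<in> X \<Longrightarrow> solves_at F u t y"
    and solves_v: "\<And>t y. T < t \<Longrightarrow> t \<le> 0 \<Longrightarrow> y \<in> X \<Longrightarrow> solves_at F v t y"
    and terminal: "\<And>y. y \<in> X \<Longrightarrow> u (0, y) = v (0, y)"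
  shows "y \<in> X \<Longrightarrow> jet u 0 y \<rho> a A \<Longrightarrow> jet v 0 y r b B \<Longrightarrow> a k 0 0 = b k 0 0"
proof (induction k arbitrary: y \<rho> a A r b B rule: less_induct)
  case (less k)
  note jets = less.prems(2,3)
  show ?case
  proof (cases k)
    case 0
    then show ?thesis
      using jet.center_value[OF jets(1)] jet.center_value[OF jets(2)] terminal[OF less.prems(1)]
      by simp
  next
    case (Suc m)
    have lower: "a j n x = b j n x" if "j \<le> m" for j n x
    proof (rule jet_coeff_eq_if_centers_eq[OF jets order_refl])
      show "\<forall>\<^sub>F z in nhds y. \<exists>\<rho>' a' A' r' b' B'.
          jet u 0 z \<rho>' a' A' \<and> jet v 0 z r' b' B' \<and> a' j 0 0 = b' j 0 0"
        using eventually_nhds_in_open[OF assms(1) less.prems(1)]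
      proof eventually_elim
        case (elim z)
        then show ?case
          using solves_u[OF assms(2), of z] solves_v[OF assms(2), of z] less.IH[of j z] that Suc
          unfolding solves_at_def by (metis le_imp_less_Suc order_refl)
      qed
    qed
    have "\<forall>\<^sub>F \<tau> in at_left 0. T < \<tau> \<and> \<tau> < 0"
      using assms(2) by (auto simp: eventually_at_left_field)
    then have "\<forall>\<^sub>F \<tau> in at_left 0. solves_at F u (0 + \<tau>) y \<and> solves_at F v (0 + \<tau>) y"
      by eventually_elim (use solves_u solves_v less.prems(1) in simp)
    from next_time_coeff_unique[OF jets _ this lower] show ?thesis by (simp add: Suc)
  qed
qed

lemma jet_center_coeffs_eqI:
  assumes "jet u t y \<rho> a A" "jet v t y r b B" "t < 0"
    and agree: "\<And>s. t < s \<Longrightarrow> s \<le> 0 \<Longrightarrow> u (s, y) = v (s, y)"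
  shows "a k 0 0 = b k 0 0"
proof -
  interpret u: jet u t y \<rho> a A by fact
  interpret v: jet v t y r b B by fact
  have "\<forall>\<^sub>F s in at_right 0. t + s \<le> 0 \<and> u (t + s, y + 0) = v (t + s, y + 0)"
    using assms(3) agree by (auto simp: eventually_at_right_field intro!: exI[of _ "- t"])
  then have "time_coeff a 0 = time_coeff b 0"
    using u.radius_pos v.radius_pos
    by (intro jet_time_coeff_eqI[OF assms(1,2), where F = "at_right 0"] at_le)
       (auto simp: eventually_conj_iff)
  then show ?thesis by (metis u.time_coeff_0 v.time_coeff_0)
qed

lemma jet_eq_at_left:
  assumes "jet u t y \<rho> a A" "jet v t y r b B" "\<And>k. a k 0 0 = b k 0 0" "t \<le> 0"
  shows "\<forall>\<^sub>F s in at_left t. u (s, y) = v (s, y)"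
proof -
  interpret u: jet u t y \<rho> a A by fact
  interpret v: jet v t y r b B by fact
  have "u (s, y) = v (s, y)" if "t - min \<rho> r < s" "s < t" for s
  proof -
    have "\<bar>s - t\<bar> \<le> \<rho>" "\<bar>s - t\<bar> \<le> r" using that by linarith+
    then show ?thesis
      using sums_unique2 u.center_expansion[of "s - t"] v.center_expansion[of "s - t"]
        that assms(3,4)
      by force
  qed
  then show ?thesis
    using u.radius_pos v.radius_pos
    by (auto simp: eventually_at_left_field intro!: exI[of _ "t - min \<rho> r"])
qed

theorem (in elliptic_operator) solution_unique:
  assumes "open X"
    and solves_u: "\<And>t y. T < t \<Longrightarrow> t \<le> 0 \<Longrightarrow> y \<in> X \<Longrightarrow> solves_at F u t y"
    and solves_v: "\<And>t y. T < t \<Longrightarrow> t \<le> 0 \<Longrightarrow> y \<in> X \<Longrightarrow> solves_at F v t y"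
    and terminal: "\<And>y. y \<in> X \<Longrightarrow> u (0, y) = v (0, y)"
    and t: "T < t" "t \<le> 0" and y: "y \<in> X"
  shows "u (t, y) = v (t, y)"
proof (rule ccontr)
  assume "u (t, y) \<noteq> v (t, y)"
  define S where "S = {s. t \<le> s \<and> s \<le> 0 \<and> u (s, y) \<noteq> v (s, y)}"
  define m where "m = Sup S"
  have S: "t \<in> S" "bdd_above S"
    using \<open>u (t, y) \<noteq> v (t, y)\<close> t by (auto simp: S_def intro!: bdd_aboveI[of _ 0])
  have m: "t \<le> m" "m \<le> 0" using S by (auto simp: m_def S_def intro!: cSup_upper cSup_least)
  have agree_after: "u (s, y) = v (s, y)" if "m < s" "s \<le> 0" for s
    using cSup_upper[OF _ S(2), of s] that m(1) unfolding m_def[symmetric] by (force simp: S_def)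
  obtain \<rho> a A r b B where jets: "jet u m y \<rho> a A" "jet v m y r b B"
    using solves_u[of m y] solves_v[of m y] m t y unfolding solves_at_def by force
  have coeffs: "a k 0 0 = b k 0 0" for k
  proof (cases "m = 0")
    case True
    have "T < 0" using t by simp
    from time_coeffs_unique[OF assms(1) this solves_u solves_v terminal y jets[unfolded True]]
    show ?thesis .
  next
    case False
    then show ?thesis using jet_center_coeffs_eqI[OF jets] agree_after m(2) by auto
  qed
  obtain s where "s < m" and agree_before: "\<And>s'. s < s' \<Longrightarrow> s' < m \<Longrightarrow> u (s', y) = v (s', y)"
    using jet_eq_at_left[OF jets coeffs m(2)] by (auto simp: eventually_at_left_field)
  have "u (m, y) = v (m, y)"
    using jet.center_value[OF jets(1)] jet.center_value[OF jets(2)] m(2) coeffs by simp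
  with agree_before agree_after have "u (s', y) = v (s', y)" if "s < s'" "s' \<le> 0" for s'
    using that by (cases s' m rule: linorder_cases) auto
  then have "m \<le> s"
    unfolding m_def using S(1) by (intro cSup_least) (auto simp: S_def not_less[symmetric])
  with \<open>s < m\<close> show False by simp
qed

subsection \<open>Parabolic homogeneity\<close>

definition parabolic_rescale :: "real \<Rightarrow> (real \<times> (real^'n) \<Rightarrow> real) \<Rightarrow> real \<times> (real^'n) \<Rightarrow> real" where
  "parabolic_rescale s u = (\<lambda>(t, x). u (s\<^sup>2 * t, s *\<^sub>R x) / s\<^sup>2)"

definition parabolic_homogeneous_on ::
  "(real \<times> (real^'n)) set \<Rightarrow> (real \<times> (real^'n) \<Rightarrow> real) \<Rightarrow> bool" where
  "parabolic_homogeneous_on S u \<longleftrightarrow>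
     (\<forall>t x s. 0 < s \<longrightarrow> (t, x) \<in> S \<longrightarrow> (s\<^sup>2 * t, s *\<^sub>R x) \<in> S \<longrightarrow> u (s\<^sup>2 * t, s *\<^sub>R x) = s\<^sup>2 * u (t, x))"

definition rescale_coeff ::
  "real \<Rightarrow> (nat \<Rightarrow> nat \<Rightarrow> real^'n \<Rightarrow> real) \<Rightarrow> nat \<Rightarrow> nat \<Rightarrow> real^'n \<Rightarrow> real" where
  "rescale_coeff s a k n x = s ^ (2 * k + n) / s\<^sup>2 * a k n x"

definition rescale_majorant :: "real \<Rightarrow> (nat \<Rightarrow> nat \<Rightarrow> real) \<Rightarrow> nat \<Rightarrow> nat \<Rightarrow> real" where
  "rescale_majorant s A k n = s ^ (2 * k + n) / s\<^sup>2 * A k n"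

lemma (in jet_coefficients) rescale_coefficients:
  assumes "0 < s" "s \<le> 1"
  shows "jet_coefficients \<rho> (rescale_coeff s a) (rescale_majorant s A)"
proof (rule jet_coefficients.intro)
  have "(\<lambda>p. 1 / s\<^sup>2 * (case p of (k, n) \<Rightarrow> A k n * \<rho> ^ (k + n))) summable_on UNIV"
    by (rule summable_on_cmult_right[OF majorant_summable])
  then show "(\<lambda>(k, n). rescale_majorant s A k n * \<rho> ^ (k + n)) summable_on UNIV"
  proof (rule summable_on_comparison_test, clarify)
    fix k n
    have "s ^ (2 * k + n) / s\<^sup>2 * (A k n * \<rho> ^ (k + n)) \<le> 1 / s\<^sup>2 * (A k n * \<rho> ^ (k + n))"
      using assms radius_pos majorant_nonneg
      by (intro mult_right_mono divide_right_mono power_le_one) auto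
    then show "rescale_majorant s A k n * \<rho> ^ (k + n) \<le> 1 / s\<^sup>2 * (A k n * \<rho> ^ (k + n))"
      by (simp add: rescale_majorant_def mult.assoc)
  qed (use assms radius_pos majorant_nonneg in \<open>auto simp: rescale_majorant_def\<close>)
  show "\<bar>rescale_coeff s a k n x\<bar> \<le> rescale_majorant s A k n * norm x ^ n" for k n x
    using mult_left_mono[OF coeff_bound[of k n x], of "s ^ (2 * k + n) / s\<^sup>2"] assms
    by (simp add: rescale_coeff_def rescale_majorant_def abs_mult mult.assoc)
  show "linear (rescale_coeff s a k 1)" for k
    unfolding rescale_coeff_def[abs_def] by (rule linear_cmult[OF linear_coeff])
  show "quadratic_form (rescale_coeff s a k 2)" for k
    unfolding rescale_coeff_def[abs_def] by (rule quadratic_form_cmult[OF quadratic_coeff])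
qed (simp_all add: radius_pos rescale_coeff_def coeff_scaleR)

lemma jet_rescale:
  assumes "jet u (s\<^sup>2 * t) (s *\<^sub>R y) \<rho> a A" and s: "0 < s" "s \<le> 1"
  shows "jet (parabolic_rescale s u) t y \<rho> (rescale_coeff s a) (rescale_majorant s A)"
proof -
  interpret jet u "s\<^sup>2 * t" "s *\<^sub>R y" \<rho> a A by fact
  show ?thesis
  proof (intro jet.intro jet_axioms.intro rescale_coefficients s)
    fix \<tau> :: real and x :: "real^'a"
    assume small: "\<bar>\<tau>\<bar> \<le> \<rho>" "norm x \<le> \<rho>" "t + \<tau> \<le> 0"
    have "\<bar>s\<^sup>2 * \<tau>\<bar> \<le> 1 * \<rho>"
      unfolding abs_mult using small s by (intro mult_mono) (auto simp: power_le_one)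
    moreover have "norm (s *\<^sub>R x) \<le> 1 * \<rho>"
      unfolding norm_scaleR using small s by (intro mult_mono) auto
    moreover have "s\<^sup>2 * (t + \<tau>) \<le> 0" using small(3) by (simp add: mult_nonneg_nonpos)
    ultimately have
      "((\<lambda>(k, n). a k n (s *\<^sub>R x) * (s\<^sup>2 * \<tau>) ^ k) has_sum u (s\<^sup>2 * (t + \<tau>), s *\<^sub>R (y + x))) UNIV"
      using expansion[of "s\<^sup>2 * \<tau>" "s *\<^sub>R x"] by (simp add: distrib_left scaleR_add_right)
    from has_sum_cmult_right[OF this, of "1 / s\<^sup>2"]
    show "((\<lambda>(k, n). rescale_coeff s a k n x * \<tau> ^ k) has_sum
        parabolic_rescale s u (t + \<tau>, y + x)) UNIV"
      by (simp add: parabolic_rescale_def rescale_coeff_def coeff_scaleR case_prod_unfold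
          power_mult_distrib power_add mult_ac flip: power_mult)
  qed
qed

lemma solves_at_rescale:
  assumes "solves_at F u (s\<^sup>2 * t) (s *\<^sub>R y)" and s: "0 < s" "s \<le> 1"
  shows "solves_at F (parabolic_rescale s u) t y"
proof -
  obtain \<rho> a A where jet: "jet u (s\<^sup>2 * t) (s *\<^sub>R y) \<rho> a A"
    and equation: "a 1 0 0 = F (form_hessian (a 0 2))"
    using assms(1) unfolding solves_at_def by blast
  have "rescale_coeff s a 0 2 = a 0 2" "rescale_coeff s a 1 0 0 = a 1 0 0"
    using s(1) by (simp_all add: rescale_coeff_def fun_eq_iff power2_eq_square)
  then show ?thesis
    using jet_rescale[OF jet s] equation unfolding solves_at_def by metis
qed

lemma solves_at_cong:
  assumes "solves_at F u t y" "\<forall>\<^sub>F p in nhds (t, y). fst p \<le> 0 \<longrightarrow> v p = u p"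
  shows "solves_at F v t y"
proof -
  obtain \<rho> a A where "jet u t y \<rho> a A" and equation: "a 1 0 0 = F (form_hessian (a 0 2))"
    using assms(1) unfolding solves_at_def by blast
  from jet.eventually_cong[OF this(1) assms(2)] equation show ?thesis
    unfolding solves_at_def by blast
qed

lemma Q1_iff: "(t, y) \<in> Q1 \<longleftrightarrow> -1 < t \<and> t \<le> 0 \<and> norm y < 1"
  by (auto simp: Q1_def)

lemma Q1_scale:
  assumes "(t, y) \<in> Q1" "0 < s" "s \<le> 1"
  shows "(s\<^sup>2 * t, s *\<^sub>R y) \<in> Q1"
proof -
  have bounds: "-1 < t" "t \<le> 0" "norm y < 1" using assms(1) by (auto simp: Q1_iff)
  have "s\<^sup>2 * (- t) \<le> 1 * (- t)" using assms bounds by (intro mult_right_mono power_le_one) auto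
  moreover have "s * norm y \<le> 1 * norm y" using assms by (intro mult_right_mono) auto
  ultimately show ?thesis using assms bounds by (auto simp: Q1_iff mult_nonneg_nonpos)
qed

lemma Q1_absorbs:
  "\<exists>s. 0 < s \<and> s \<le> 1 \<and>
    (\<forall>t y. - R < t \<longrightarrow> t \<le> 0 \<longrightarrow> norm y < R \<longrightarrow> (s\<^sup>2 * t, s *\<^sub>R y) \<in> Q1)"
proof (intro exI conjI allI impI)
  define s where "s = 1 / max R 1"
  show s: "0 < s" "s \<le> 1" by (auto simp: s_def)
  fix t and y :: "real^'n"
  assume bounds: "- R < t" "t \<le> 0" "norm y < R"
  have "s\<^sup>2 * (- t) \<le> s * (- t)"
    using s bounds by (intro mult_right_mono) (auto simp: power2_eq_square)
  moreover have "- t < max R 1" "norm y < max R 1" using bounds by auto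
  then have "s * (- t) < 1" "s * norm y < 1"
    by (simp_all add: s_def pos_less_divide_eq pos_divide_less_eq)
  ultimately show "(s\<^sup>2 * t, s *\<^sub>R y) \<in> Q1" using s bounds by (auto simp: Q1_iff mult_nonneg_nonpos)
qed

context elliptic_operator
begin

lemma solution_rescale_invariant:
  assumes sol: "\<And>t y. (t, y) \<in> Q1 - {(0, 0)} \<Longrightarrow> solves_at F u t y"
    and terminal: "\<And>x. x \<in> ball 0 1 \<Longrightarrow> s *\<^sub>R x \<in> ball 0 1 \<Longrightarrow> u (0, s *\<^sub>R x) = s\<^sup>2 * u (0, x)"
    and "(t, y) \<in> Q1" "y \<noteq> 0" and s: "0 < s" "s \<le> 1"
  shows "u (t, y) = parabolic_rescale s u (t, y)"
proof (rule solution_unique[where X = "ball 0 1 - {0}" and T = "-1"])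
  show "open (ball (0 :: real^'n) 1 - {0})" by (intro open_Diff) auto
  fix t :: real and y :: "real^'n" assume domain: "-1 < t" "t \<le> 0" "y \<in> ball 0 1 - {0}"
  then have "(t, y) \<in> Q1" by (auto simp: Q1_iff)
  with domain show "solves_at F u t y" by (intro sol) auto
  show "solves_at F (parabolic_rescale s u) t y"
    by (intro solves_at_rescale s sol) (use Q1_scale[OF \<open>(t, y) \<in> Q1\<close> s] domain s in auto)
next
  fix y :: "real^'n" assume y: "y \<in> ball 0 1 - {0}"
  then have "s *\<^sub>R y \<in> ball 0 1" using Q1_scale[of 0 y s] s by (auto simp: Q1_iff)
  then show "u (0, y) = parabolic_rescale s u (0, y)"
    using terminal[of y] y s by (simp add: parabolic_rescale_def)
qed (use assms(3,4) in \<open>auto simp: Q1_iff\<close>)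

lemma solution_contraction:
  assumes cont: "continuous_on Q1 u"
    and sol: "\<And>t y. (t, y) \<in> Q1 - {(0, 0)} \<Longrightarrow> solves_at F u t y"
    and terminal: "\<And>x. x \<in> ball 0 1 \<Longrightarrow> s *\<^sub>R x \<in> ball 0 1 \<Longrightarrow> u (0, s *\<^sub>R x) = s\<^sup>2 * u (0, x)"
    and "(t, y) \<in> Q1" and s: "0 < s" "s \<le> 1"
  shows "u (s\<^sup>2 * t, s *\<^sub>R y) = s\<^sup>2 * u (t, y)"
proof -
  have off_axis: "u (s\<^sup>2 * t, s *\<^sub>R y) = s\<^sup>2 * u (t, y)"
    if "(t, y) \<in> Q1" "y \<noteq> 0" for t and y :: "real^'n"
    using solution_rescale_invariant[OF sol terminal that s] s(1)
    by (simp add: parabolic_rescale_def)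
  show ?thesis
  proof (cases "y = 0")
    case True
    define f where "f x = u (s\<^sup>2 * t, s *\<^sub>R x) - s\<^sup>2 * u (t, x)" for x
    have domain: "(t, x) \<in> Q1" "(s\<^sup>2 * t, s *\<^sub>R x) \<in> Q1" if "x \<in> ball 0 1" for x :: "real^'n"
      using Q1_scale[OF _ s, of t x] that assms(4) by (auto simp: Q1_iff)
    have "continuous_on (ball 0 1) f"
      unfolding f_def
      by (intro continuous_intros continuous_on_compose2[OF cont]) (use domain in auto)
    then have "(f \<longlongrightarrow> f 0) (at 0)" by (simp add: continuous_on_eq_continuous_at isCont_def)
    moreover have "\<forall>\<^sub>F x in at 0. f x = 0"
      unfolding eventually_at using domain off_axis by (intro exI[of _ 1]) (auto simp: f_def)
    ultimately have "f 0 = 0" using tendsto_unique[OF at_neq_bot _ tendsto_eventually] by blast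
    then show ?thesis using True by (simp add: f_def)
  qed (use off_axis assms(4) in simp)
qed

lemma solution_parabolic_homogeneous:
  assumes "continuous_on Q1 u" "\<And>t y. (t, y) \<in> Q1 - {(0, 0)} \<Longrightarrow> solves_at F u t y"
    and terminal: "\<And>s x. 0 < s \<Longrightarrow> x \<in> ball 0 1 \<Longrightarrow> s *\<^sub>R x \<in> ball 0 1 \<Longrightarrow>
      u (0, s *\<^sub>R x) = s\<^sup>2 * u (0, x)"
  shows "parabolic_homogeneous_on Q1 u"
  unfolding parabolic_homogeneous_on_def
proof (intro allI impI)
  fix t s :: real and y :: "real^'n"
  assume "0 < s" and domain: "(t, y) \<in> Q1" "(s\<^sup>2 * t, s *\<^sub>R y) \<in> Q1"
  have contraction: "u (r\<^sup>2 * t, r *\<^sub>R y) = r\<^sup>2 * u (t, y)"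
    if "(t, y) \<in> Q1" "0 < r" "r \<le> 1" for t r and y :: "real^'n"
    by (rule solution_contraction[OF assms(1,2) terminal[OF that(2)] that])
  show "u (s\<^sup>2 * t, s *\<^sub>R y) = s\<^sup>2 * u (t, y)"
  proof (cases "s \<le> 1")
    case False
    then show ?thesis using contraction[OF domain(2), of "1 / s"] by (simp add: power_divide)
  qed (use contraction[OF domain(1) \<open>0 < s\<close>] in simp)
qed

end

definition parabolic_extension :: "(real \<times> (real^'n) \<Rightarrow> real) \<Rightarrow> real \<times> (real^'n) \<Rightarrow> real" where
  "parabolic_extension u p = Lim (at_right 0) (\<lambda>s. parabolic_rescale s u p)"

context
  fixes u :: "real \<times> (real^'n) \<Rightarrow> real"
  assumes homogeneous: "parabolic_homogeneous_on Q1 u"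
begin

lemma parabolic_extension_eq_rescale:
  assumes "0 < s" "(s\<^sup>2 * t, s *\<^sub>R y) \<in> Q1"
  shows "parabolic_extension u (t, y) = parabolic_rescale s u (t, y)"
  unfolding parabolic_extension_def
proof (rule tendsto_Lim[OF _ tendsto_eventually])
  have "\<forall>\<^sub>F r in at_right 0. 0 < r \<and> r < s"
    using assms(1) by (auto simp: eventually_at_right_field)
  then show "\<forall>\<^sub>F r in at_right 0. parabolic_rescale r u (t, y) = parabolic_rescale s u (t, y)"
  proof eventually_elim
    case (elim r)
    have "((r / s)\<^sup>2 * (s\<^sup>2 * t), (r / s) *\<^sub>R s *\<^sub>R y) \<in> Q1"
      by (rule Q1_scale[OF assms(2)]) (use elim in auto)
    moreover have "0 < r / s" using elim assms(1) by simp
    ultimately have "u ((r / s)\<^sup>2 * (s\<^sup>2 * t), (r / s) *\<^sub>R s *\<^sub>R y)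
        = (r / s)\<^sup>2 * u (s\<^sup>2 * t, s *\<^sub>R y)"
      using homogeneous assms(2) unfolding parabolic_homogeneous_on_def by blast
    then show ?case using elim assms(1) by (simp add: parabolic_rescale_def power_divide)
  qed
qed simp

lemma parabolic_extension_eq:
  assumes "p \<in> Q1"
  shows "parabolic_extension u p = u p"
  using parabolic_extension_eq_rescale[of 1 "fst p" "snd p"] assms
  by (simp add: parabolic_rescale_def)

lemma parabolic_extension_homogeneous:
  "parabolic_homogeneous_on ({..0} \<times> UNIV) (parabolic_extension u)"
  unfolding parabolic_homogeneous_on_def
proof (intro allI impI)
  fix t s :: real and y :: "real^'n"
  assume "0 < s" "(t, y) \<in> {..0} \<times> UNIV" and past: "(s\<^sup>2 * t, s *\<^sub>R y) \<in> {..0} \<times> UNIV"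
  define R where "R = \<bar>s\<^sup>2 * t\<bar> + norm (s *\<^sub>R y) + 1"
  have "- R < s\<^sup>2 * t" "norm (s *\<^sub>R y) < R"
    using norm_ge_zero[of "s *\<^sub>R y"] unfolding R_def by linarith+
  then obtain r where r: "0 < r" "(r\<^sup>2 * (s\<^sup>2 * t), r *\<^sub>R s *\<^sub>R y) \<in> Q1"
    using Q1_absorbs[of R] past by blast
  then have "((r * s)\<^sup>2 * t, (r * s) *\<^sub>R y) \<in> Q1" by (simp add: power_mult_distrib mult.assoc)
  with parabolic_extension_eq_rescale[OF _ this] parabolic_extension_eq_rescale[OF r] r \<open>0 < s\<close>
  show "parabolic_extension u (s\<^sup>2 * t, s *\<^sub>R y) = s\<^sup>2 * parabolic_extension u (t, y)"
    by (simp add: parabolic_rescale_def power_mult_distrib mult.assoc)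
qed

lemma parabolic_extension_solves_at:
  assumes "\<And>t y. (t, y) \<in> Q1 - {(0, 0)} \<Longrightarrow> solves_at F u t y" "t \<le> 0" "(t, y) \<noteq> (0, 0)"
  shows "solves_at F (parabolic_extension u) t y"
proof -
  define R where "R = \<bar>t\<bar> + norm y + 1"
  have R: "- R < t" "norm y < R" using norm_ge_zero[of y] unfolding R_def by linarith+
  obtain s where s: "0 < s" "s \<le> 1"
    and scaled_in_Q1: "\<And>t (y :: real^'n). - R < t \<Longrightarrow> t \<le> 0 \<Longrightarrow> norm y < R \<Longrightarrow> (s\<^sup>2 * t, s *\<^sub>R y) \<in> Q1"
    using Q1_absorbs[of R] by blast
  show ?thesis
  proof (rule solves_at_cong)
    have "(s\<^sup>2 * t, s *\<^sub>R y) \<in> Q1 - {(0, 0)}"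
      using scaled_in_Q1[of t y] R assms(2,3) s by auto
    then show "solves_at F (parabolic_rescale s u) t y" by (intro solves_at_rescale assms(1) s)
    have "open ({- R <..} \<times> ball 0 R)" "(t, y) \<in> {- R <..} \<times> ball 0 R"
      using R by (auto intro!: open_Times)
    from eventually_nhds_in_open[OF this]
    show "\<forall>\<^sub>F p in nhds (t, y). fst p \<le> 0 \<longrightarrow> parabolic_extension u p = parabolic_rescale s u p"
      by eventually_elim (auto intro!: parabolic_extension_eq_rescale s scaled_in_Q1)
  qed
qed

end

subsection \<open>A Liouville theorem\<close>

lemma DERIV_second_order_local_max:
  fixes f f' :: "real \<Rightarrow> real"
  assumes deriv: "\<forall>\<^sub>F s in nhds x. (f has_real_derivative f' s) (at s)"
    and deriv2: "(f' has_real_derivative D) (at x)"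
    and max: "\<forall>\<^sub>F s in nhds x. f s \<le> f x"
  shows "f' x = 0" "D \<le> 0"
proof -
  obtain \<delta> where "0 < \<delta>"
    and near: "\<And>s. \<bar>s - x\<bar> < \<delta> \<Longrightarrow> (f has_real_derivative f' s) (at s) \<and> f s \<le> f x"
    using eventually_conj[OF deriv max] by (auto simp: eventually_nhds_metric dist_real_def)
  show critical: "f' x = 0"
    using DERIV_local_max[of f "f' x" x \<delta>] \<open>0 < \<delta>\<close> near by (auto simp: abs_minus_commute)
  show "D \<le> 0"
  proof (rule ccontr)
    assume "\<not> D \<le> 0"
    then obtain d where "d > 0" and increasing: "\<And>s. 0 < s \<Longrightarrow> s < d \<Longrightarrow> 0 < f' (x + s)"
      using DERIV_pos_inc_right[OF deriv2] critical by auto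
    define r where "r = min d \<delta> / 2"
    have r: "0 < r" "r < d" "r < \<delta>" using \<open>0 < d\<close> \<open>0 < \<delta>\<close> by (auto simp: r_def min_def)
    obtain s where s: "x < s" "s < x + r" and mvt: "f (x + r) - f x = (x + r - x) * f' s"
      using MVT2[of x "x + r" f f'] r near by auto
    have "0 < r * f' s" using increasing[of "s - x"] s r by (intro mult_pos_pos) auto
    then show False using mvt near[of "x + r"] r by simp
  qed
qed

lemma (in jet) space_local_max:
  assumes "t \<le> 0"
    and deriv: "\<And>s. ((\<lambda>s. \<phi> (y + s *\<^sub>R x)) has_real_derivative \<phi>' s) (at s)"
    and deriv2: "(\<phi>' has_real_derivative D) (at 0)"
    and max: "\<forall>\<^sub>F z in nhds y. u (t, z) + \<phi> z \<le> u (t, y) + \<phi> y"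
  shows "a 0 1 x = - \<phi>' 0" "2 * a 0 2 x \<le> - D"
proof -
  obtain g where g: "\<forall>\<^sub>F s in nhds 0. ((\<lambda>s. u (t, y + s *\<^sub>R x)) has_real_derivative g s) (at s)"
    "g 0 = a 0 1 x" "(g has_real_derivative 2 * a 0 2 x) (at 0)"
    using line_derivatives[OF assms(1)] by blast
  let ?f = "\<lambda>s. u (t, y + s *\<^sub>R x) + \<phi> (y + s *\<^sub>R x)"
  have sum_deriv: "\<forall>\<^sub>F s in nhds 0. (?f has_real_derivative g s + \<phi>' s) (at s)"
    using g(1) by eventually_elim (intro DERIV_add deriv)
  have "((\<lambda>s. y + s *\<^sub>R x) \<longlongrightarrow> y + 0 *\<^sub>R x) (nhds 0)" by (intro tendsto_intros filterlim_ident)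
  from eventually_compose_filterlim[OF _ this] max have "\<forall>\<^sub>F s in nhds 0. ?f s \<le> ?f 0" by simp
  from DERIV_second_order_local_max[OF sum_deriv DERIV_add[OF g(3) deriv2] this] g(2)
  show "a 0 1 x = - \<phi>' 0" "2 * a 0 2 x \<le> - D" by simp_all
qed

text \<open>
  The concave part \<open>- \<eta> |y|\<^sup>2\<close> forces a maximum to exist; far from the origin its drift term
  \<open>\<eta> |y|\<^sup>2\<close> beats its second derivatives, and near the origin \<open>\<eta>\<close> is negligible against the
  exponential.
\<close>

definition barrier :: "real \<Rightarrow> real \<Rightarrow> real \<Rightarrow> 'a::real_inner \<Rightarrow> 'a \<Rightarrow> real" where
  "barrier \<alpha> \<epsilon> \<eta> y\<^sub>0 y = \<epsilon> * exp (- \<alpha> * (norm (y - y\<^sub>0))\<^sup>2) - \<eta> * (norm y)\<^sup>2"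

lemma norm_add_scaleR_power2:
  fixes z x :: "'a::real_inner"
  shows "(norm (z + s *\<^sub>R x))\<^sup>2 = (norm z)\<^sup>2 + 2 * (z \<bullet> x) * s + (norm x)\<^sup>2 * s\<^sup>2"
  unfolding power2_norm_eq_inner
  by (simp add: inner_add_left inner_add_right inner_commute[of x z] power2_eq_square algebra_simps)

lemma barrier_line_derivatives:
  fixes y x y\<^sub>0 :: "'a::real_inner" and \<alpha> \<epsilon> \<eta> :: real
  defines "z \<equiv> y - y\<^sub>0" and "b \<equiv> \<epsilon> * exp (- \<alpha> * (norm (y - y\<^sub>0))\<^sup>2)"
  obtains g where "\<And>s. ((\<lambda>s. barrier \<alpha> \<epsilon> \<eta> y\<^sub>0 (y + s *\<^sub>R x)) has_real_derivative g s) (at s)"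
    and "g 0 = - (2 * \<alpha> * b * (z \<bullet> x) + 2 * \<eta> * (y \<bullet> x))"
    and "(g has_real_derivative 4 * \<alpha>\<^sup>2 * b * (z \<bullet> x)\<^sup>2 - 2 * (\<alpha> * b + \<eta>) * (norm x)\<^sup>2) (at 0)"
proof
  let ?n = "\<lambda>v s. (norm v)\<^sup>2 + 2 * (v \<bullet> x) * s + (norm x)\<^sup>2 * s\<^sup>2"
  let ?n' = "\<lambda>v s. 2 * (v \<bullet> x) + 2 * (norm x)\<^sup>2 * s"
  define g where "g s = \<epsilon> * exp (- \<alpha> * ?n z s) * (- \<alpha> * ?n' z s) - \<eta> * ?n' y s" for s
  have line: "barrier \<alpha> \<epsilon> \<eta> y\<^sub>0 (y + s *\<^sub>R x) = \<epsilon> * exp (- \<alpha> * ?n z s) - \<eta> * ?n y s" for s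
  proof -
    have "y + s *\<^sub>R x - y\<^sub>0 = z + s *\<^sub>R x" by (simp add: z_def)
    then show ?thesis
      unfolding barrier_def norm_add_scaleR_power2[of y] by (simp only: norm_add_scaleR_power2)
  qed
  show "((\<lambda>s. barrier \<alpha> \<epsilon> \<eta> y\<^sub>0 (y + s *\<^sub>R x)) has_real_derivative g s) (at s)" for s
    unfolding line by (auto intro!: derivative_eq_intros simp: g_def algebra_simps)
  show "g 0 = - (2 * \<alpha> * b * (z \<bullet> x) + 2 * \<eta> * (y \<bullet> x))"
    by (simp add: g_def b_def z_def)
  show "(g has_real_derivative 4 * \<alpha>\<^sup>2 * b * (z \<bullet> x)\<^sup>2 - 2 * (\<alpha> * b + \<eta>) * (norm x)\<^sup>2) (at 0)"
    unfolding g_def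
    by (auto intro!: derivative_eq_intros
        simp: b_def z_def[symmetric] algebra_simps power2_eq_square)
qed

text \<open>
  At a maximum of \<open>W + barrier\<close> the gradient of \<open>W\<close> is that of \<open>- barrier\<close>: the left side is half
  its radial component, the right side what ellipticity allows for the second derivatives.
\<close>

definition barrier_max_inequality ::
  "real \<Rightarrow> real \<Rightarrow> real \<Rightarrow> real \<Rightarrow> real \<Rightarrow> 'a::real_inner \<Rightarrow> 'a \<Rightarrow> bool" where
  "barrier_max_inequality lam L \<alpha> \<epsilon> \<eta> y\<^sub>0 y \<longleftrightarrow>
    (let z = y - y\<^sub>0; b = \<epsilon> * exp (- \<alpha> * (norm z)\<^sup>2) in
      \<alpha> * b * (z \<bullet> y) + \<eta> * (norm y)\<^sup>2 \<le> 2 * L * (\<alpha> * b + \<eta>) - 4 * lam * \<alpha>\<^sup>2 * b * (norm z)\<^sup>2)"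

lemma barrier_max_inequality_imp_le:
  fixes y\<^sub>0 :: "'a::real_inner"
  assumes max: "barrier_max_inequality lam L \<alpha> \<epsilon> \<eta> y\<^sub>0 y" and "0 < lam" "0 < \<alpha>" "0 < \<epsilon>"
    and steep: "2 * L + (norm y\<^sub>0)\<^sup>2 / 4 + 1 \<le> 4 * lam * \<alpha> * (norm (y - y\<^sub>0))\<^sup>2"
  shows "\<alpha> * (\<epsilon> * exp (- \<alpha> * (norm (y - y\<^sub>0))\<^sup>2)) + \<eta> * ((norm y)\<^sup>2 - 2 * L) \<le> 0"
proof -
  define z where "z = y - y\<^sub>0"
  define b where "b = \<epsilon> * exp (- \<alpha> * (norm z)\<^sup>2)"
  have rearranged:
    "\<alpha> * b * (z \<bullet> y - 2 * L + 4 * lam * \<alpha> * (norm z)\<^sup>2) + \<eta> * ((norm y)\<^sup>2 - 2 * L) \<le> 0"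
    using max
    by (simp add: barrier_max_inequality_def Let_def z_def b_def algebra_simps power2_eq_square)
  have "0 \<le> (norm (z + (1 / 2) *\<^sub>R y\<^sub>0))\<^sup>2" by simp
  then have "- ((norm y\<^sub>0)\<^sup>2 / 4) \<le> z \<bullet> y"
    unfolding norm_add_scaleR_power2
    by (simp add: z_def inner_diff_left inner_diff_right power2_norm_eq_inner inner_commute
        field_simps)
  with steep have "1 \<le> z \<bullet> y - 2 * L + 4 * lam * \<alpha> * (norm z)\<^sup>2" by (simp add: z_def)
  then have "\<alpha> * b * 1 \<le> \<alpha> * b * (z \<bullet> y - 2 * L + 4 * lam * \<alpha> * (norm z)\<^sup>2)"
    using assms(3,4) by (intro mult_left_mono) (auto simp: b_def)
  with rearranged show ?thesis by (simp add: b_def z_def)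
qed

lemma ex_barrier_without_max:
  fixes y\<^sub>0 :: "'a::real_inner"
  assumes "0 < lam" "0 < L" "0 < \<delta>" "0 < \<epsilon>"
  shows "\<exists>\<alpha>>0. \<forall>\<^sub>F \<eta> in at_right 0. \<forall>y. \<delta> \<le> norm (y - y\<^sub>0) \<longrightarrow>
    \<not> barrier_max_inequality lam L \<alpha> \<epsilon> \<eta> y\<^sub>0 y"
proof -
  define k where "k = 2 * L + (norm y\<^sub>0)\<^sup>2 / 4 + 1"
  define \<alpha> where "\<alpha> = k / (4 * lam * \<delta>\<^sup>2)"
  have "0 < k" using assms by (simp add: k_def add_pos_nonneg)
  then have "0 < \<alpha>" and steep: "4 * lam * \<alpha> * \<delta>\<^sup>2 = k" using assms by (simp_all add: \<alpha>_def)
  define b\<^sub>0 where "b\<^sub>0 = \<epsilon> * exp (- \<alpha> * (sqrt (2 * L) + norm y\<^sub>0)\<^sup>2)"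
  have "\<not> barrier_max_inequality lam L \<alpha> \<epsilon> \<eta> y\<^sub>0 y"
    if \<eta>: "0 < \<eta>" "\<eta> < \<alpha> * b\<^sub>0 / (2 * L)" and y: "\<delta> \<le> norm (y - y\<^sub>0)" for \<eta> y
  proof
    define b where "b = \<epsilon> * exp (- \<alpha> * (norm (y - y\<^sub>0))\<^sup>2)"
    assume max: "barrier_max_inequality lam L \<alpha> \<epsilon> \<eta> y\<^sub>0 y"
    have "4 * lam * \<alpha> * \<delta>\<^sup>2 \<le> 4 * lam * \<alpha> * (norm (y - y\<^sub>0))\<^sup>2"
      using y assms \<open>0 < \<alpha>\<close> by (intro mult_left_mono power_mono) auto
    then have upper: "\<alpha> * b + \<eta> * ((norm y)\<^sup>2 - 2 * L) \<le> 0"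
      using barrier_max_inequality_imp_le[OF max assms(1) \<open>0 < \<alpha>\<close> assms(4)] steep
      by (simp add: k_def b_def)
    moreover have "0 < \<alpha> * b" using \<open>0 < \<alpha>\<close> assms(4) by (simp add: b_def)
    ultimately have "\<eta> * ((norm y)\<^sup>2 - 2 * L) < 0" by linarith
    then have "(norm y)\<^sup>2 < 2 * L" using \<eta>(1) by (simp add: mult_less_0_iff)
    then have "norm y \<le> sqrt (2 * L)" using real_le_rsqrt by simp
    then have "norm (y - y\<^sub>0) \<le> sqrt (2 * L) + norm y\<^sub>0" using norm_triangle_ineq4[of y y\<^sub>0] by simp
    then have "b\<^sub>0 \<le> b" using \<open>0 < \<alpha>\<close> assms(4) by (auto simp: b\<^sub>0_def b_def intro!: power_mono)
    then have "\<alpha> * b\<^sub>0 \<le> \<alpha> * b" using \<open>0 < \<alpha>\<close> by simp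
    moreover have "\<eta> * (2 * L) < \<alpha> * b\<^sub>0" using \<eta>(2) assms(2) by (simp add: pos_less_divide_eq)
    moreover have "0 \<le> \<eta> * (norm y)\<^sup>2" using \<eta>(1) by simp
    ultimately show False using upper by (simp add: algebra_simps)
  qed
  moreover have "0 < \<alpha> * b\<^sub>0 / (2 * L)" using \<open>0 < \<alpha>\<close> assms by (simp add: b\<^sub>0_def)
  ultimately show ?thesis
    using \<open>0 < \<alpha>\<close> unfolding eventually_at_right_field by blast
qed

lemma attains_sup_if_at_bot_at_infinity:
  fixes f :: "'a::{real_normed_vector, heine_borel} \<Rightarrow> real"
  assumes "closed S" "S \<noteq> {}" "continuous_on S f" "filterlim f at_bot at_infinity"
  shows "\<exists>x\<in>S. \<forall>y\<in>S. f y \<le> f x"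
proof -
  obtain x\<^sub>0 where "x\<^sub>0 \<in> S" using assms(2) by blast
  obtain R where far: "\<And>x. R \<le> norm x \<Longrightarrow> f x \<le> f x\<^sub>0"
    using assms(4) unfolding filterlim_at_bot eventually_at_infinity by blast
  let ?K = "S \<inter> cball 0 (max R (norm x\<^sub>0))"
  have "compact ?K" using assms(1) by (simp add: closed_Int_compact)
  moreover have "x\<^sub>0 \<in> ?K" using \<open>x\<^sub>0 \<in> S\<close> by simp
  ultimately obtain x where "x \<in> ?K" and max: "\<And>y. y \<in> ?K \<Longrightarrow> f y \<le> f x"
    using continuous_attains_sup[of ?K f] continuous_on_subset[OF assms(3), of ?K] by blast
  have "f y \<le> f x" if "y \<in> S" for y
  proof (cases "norm y \<le> max R (norm x\<^sub>0)")
    case True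
    then show ?thesis using max that by simp
  next
    case False
    then have "f y \<le> f x\<^sub>0" using far by simp
    also have "\<dots> \<le> f x" using max \<open>x\<^sub>0 \<in> ?K\<close> by blast
    finally show ?thesis .
  qed
  then show ?thesis using \<open>x \<in> ?K\<close> by blast
qed

lemma filterlim_bounded_add_barrier:
  fixes W :: "'a::real_inner \<Rightarrow> real"
  assumes "bounded (range W)" "0 \<le> \<alpha>" "0 \<le> \<epsilon>" "0 < \<eta>"
  shows "filterlim (\<lambda>x. W x + barrier \<alpha> \<epsilon> \<eta> y\<^sub>0 x) at_bot at_infinity"
proof -
  obtain B where bound: "\<And>x. \<bar>W x\<bar> \<le> B" using assms(1) by (auto simp: bounded_iff)
  have "filterlim (\<lambda>x :: 'a. (norm x)\<^sup>2) at_top at_infinity"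
    by (intro filterlim_pow_at_top filterlim_norm_at_top) simp
  then have "filterlim (\<lambda>x :: 'a. - (B + \<epsilon>) + \<eta> * (norm x)\<^sup>2) at_top at_infinity"
    by (intro filterlim_tendsto_add_at_top[OF tendsto_const]
        filterlim_tendsto_pos_mult_at_top[OF tendsto_const assms(4)])
  then have "filterlim (\<lambda>x :: 'a. - (W x + barrier \<alpha> \<epsilon> \<eta> y\<^sub>0 x)) at_top at_infinity"
  proof (rule filterlim_at_top_mono, intro always_eventually allI)
    fix x :: 'a
    have "\<epsilon> * exp (- \<alpha> * (norm (x - y\<^sub>0))\<^sup>2) \<le> \<epsilon>"
      using assms(2,3) by (intro mult_left_le) auto
    then show "- (B + \<epsilon>) + \<eta> * (norm x)\<^sup>2 \<le> - (W x + barrier \<alpha> \<epsilon> \<eta> y\<^sub>0 x)"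
      using bound[of x] by (simp add: barrier_def abs_le_iff)
  qed
  then show ?thesis by (simp add: filterlim_uminus_at_bot)
qed

lemma le_outside_if_no_barrier_max:
  fixes W :: "'a::euclidean_space \<Rightarrow> real"
  assumes W: "continuous_on UNIV W" "bounded (range W)"
    and pos: "0 \<le> \<alpha>" "0 \<le> \<epsilon>" "0 < \<eta>"
    and no_max: "\<And>y. \<delta> < norm (y - y\<^sub>0) \<Longrightarrow>
      \<not> (\<forall>\<^sub>F x in nhds y. W x + barrier \<alpha> \<epsilon> \<eta> y\<^sub>0 x \<le> W y + barrier \<alpha> \<epsilon> \<eta> y\<^sub>0 y)"
    and sphere: "\<And>y. norm (y - y\<^sub>0) = \<delta> \<Longrightarrow> W y \<le> c - \<epsilon>"
    and y: "\<delta> \<le> norm (y - y\<^sub>0)"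
  shows "W y + barrier \<alpha> \<epsilon> \<eta> y\<^sub>0 y \<le> c"
proof -
  define V where "V x = W x + barrier \<alpha> \<epsilon> \<eta> y\<^sub>0 x" for x
  let ?S = "{x. \<delta> \<le> norm (x - y\<^sub>0)}"
  have "closed ?S" by (intro closed_Collect_le continuous_intros)
  moreover have "continuous_on ?S V"
    unfolding V_def barrier_def
    by (intro continuous_intros continuous_on_subset[OF W(1)]) auto
  moreover have "filterlim V at_bot at_infinity"
    unfolding V_def by (rule filterlim_bounded_add_barrier[OF W(2) pos])
  ultimately obtain x where x: "\<delta> \<le> norm (x - y\<^sub>0)"
    and max: "\<And>z. \<delta> \<le> norm (z - y\<^sub>0) \<Longrightarrow> V z \<le> V x"
    using attains_sup_if_at_bot_at_infinity[of ?S V] y by blast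
  have "norm (x - y\<^sub>0) = \<delta>"
  proof (rule ccontr)
    assume "norm (x - y\<^sub>0) \<noteq> \<delta>"
    moreover have "open {z. \<delta> < norm (z - y\<^sub>0)}" by (intro open_Collect_less continuous_intros)
    ultimately have "\<forall>\<^sub>F z in nhds x. \<delta> < norm (z - y\<^sub>0)"
      using x eventually_nhds_in_open by force
    then have "\<forall>\<^sub>F z in nhds x. V z \<le> V x" by eventually_elim (use max in simp)
    with no_max[of x] x \<open>norm (x - y\<^sub>0) \<noteq> \<delta>\<close> show False by (simp add: V_def)
  qed
  moreover have "\<epsilon> * exp (- \<alpha> * (norm (x - y\<^sub>0))\<^sup>2) \<le> \<epsilon>" "0 \<le> \<eta> * (norm x)\<^sup>2"
    using pos by (auto intro: mult_left_le)
  ultimately have "V x \<le> c" using sphere[of x] by (simp add: V_def barrier_def)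
  with max[OF y] show ?thesis by (simp add: V_def)
qed

lemma le_if_no_barrier_max_inequality:
  fixes W :: "'a::euclidean_space \<Rightarrow> real"
  assumes W: "continuous_on UNIV W" "bounded (range W)" and pos: "0 < \<alpha>" "0 < \<epsilon>"
    and max: "\<And>\<eta> y. 0 < \<eta> \<Longrightarrow>
      \<forall>\<^sub>F x in nhds y. W x + barrier \<alpha> \<epsilon> \<eta> y\<^sub>0 x \<le> W y + barrier \<alpha> \<epsilon> \<eta> y\<^sub>0 y \<Longrightarrow>
      barrier_max_inequality lam L \<alpha> \<epsilon> \<eta> y\<^sub>0 y"
    and no_max: "\<forall>\<^sub>F \<eta> in at_right 0. \<forall>y. \<delta> \<le> norm (y - y\<^sub>0) \<longrightarrow>
      \<not> barrier_max_inequality lam L \<alpha> \<epsilon> \<eta> y\<^sub>0 y"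
    and near: "\<And>y. norm (y - y\<^sub>0) \<le> \<delta> \<Longrightarrow> W y \<le> c - \<epsilon>"
  shows "W y \<le> c"
proof (cases "norm (y - y\<^sub>0) \<le> \<delta>")
  case False
  have "\<forall>\<^sub>F \<eta> in at_right 0. 0 < (\<eta> :: real)" by (simp add: eventually_at_filter)
  with no_max have "\<forall>\<^sub>F \<eta> in at_right 0. W y - c \<le> (norm y)\<^sup>2 * \<bar>\<eta>\<bar>"
  proof eventually_elim
    case (elim \<eta>)
    have "W y + barrier \<alpha> \<epsilon> \<eta> y\<^sub>0 y \<le> c"
    proof (rule le_outside_if_no_barrier_max[OF W _ _ elim(2)])
      show "\<not> (\<forall>\<^sub>F x in nhds y. W x + barrier \<alpha> \<epsilon> \<eta> y\<^sub>0 x \<le> W y + barrier \<alpha> \<epsilon> \<eta> y\<^sub>0 y)"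
        if "\<delta> < norm (y - y\<^sub>0)" for y
        using elim(1) less_imp_le[OF that] max[OF elim(2)] by blast
    qed (use pos near False in auto)
    moreover have "0 \<le> \<epsilon> * exp (- \<alpha> * (norm (y - y\<^sub>0))\<^sup>2)" using pos by simp
    ultimately show ?case using elim(2) by (simp add: barrier_def mult.commute)
  qed
  from nonpos_if_eventually_le_abs[OF _ at_le this] show ?thesis by simp
qed (use near[of y] pos(2) in simp)

theorem drift_liouville:
  fixes W :: "'a::euclidean_space \<Rightarrow> real"
  assumes W: "continuous_on UNIV W" "bounded (range W)" and pos: "0 < lam" "0 < L"
    and max: "\<And>\<alpha> \<epsilon> \<eta> y\<^sub>0 y. 0 < \<alpha> \<Longrightarrow> 0 < \<epsilon> \<Longrightarrow> 0 < \<eta> \<Longrightarrow>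
      \<forall>\<^sub>F x in nhds y. W x + barrier \<alpha> \<epsilon> \<eta> y\<^sub>0 x \<le> W y + barrier \<alpha> \<epsilon> \<eta> y\<^sub>0 y \<Longrightarrow>
      barrier_max_inequality lam L \<alpha> \<epsilon> \<eta> y\<^sub>0 y"
  shows "W y = Sup (range W)"
proof (rule ccontr)
  define m where "m = Sup (range W)"
  have le_m: "W x \<le> m" for x
    unfolding m_def using W(2) by (intro cSup_upper bounded_imp_bdd_above) auto
  assume "W y \<noteq> Sup (range W)"
  then have "0 < m - W y" using le_m[of y] by (simp add: m_def)
  define \<epsilon> where "\<epsilon> = (m - W y) / 3"
  have \<epsilon>: "0 < \<epsilon>" "W y < m - 2 * \<epsilon>" using \<open>0 < m - W y\<close> by (auto simp: \<epsilon>_def field_simps)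
  have "(W \<longlongrightarrow> W y) (nhds y)"
    using W(1) by (simp add: continuous_on_eq_continuous_at isCont_def tendsto_at_iff_tendsto_nhds)
  then have "\<forall>\<^sub>F x in nhds y. W x < m - 2 * \<epsilon>" using \<epsilon>(2) by (intro order_tendstoD) auto
  then obtain d where "0 < d" and near_d: "\<And>x. dist x y < d \<Longrightarrow> W x < m - 2 * \<epsilon>"
    by (auto simp: eventually_nhds_metric)
  define \<delta> where "\<delta> = d / 2"
  have "0 < \<delta>" using \<open>0 < d\<close> by (simp add: \<delta>_def)
  have near: "W x \<le> m - \<epsilon> - \<epsilon>" if "norm (x - y) \<le> \<delta>" for x
    using near_d[of x] that \<open>0 < d\<close> by (simp add: \<delta>_def dist_norm)
  obtain \<alpha> where "0 < \<alpha>" and no_max: "\<forall>\<^sub>F \<eta> in at_right 0. \<forall>x. \<delta> \<le> norm (x - y) \<longrightarrow>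
      \<not> barrier_max_inequality lam L \<alpha> \<epsilon> \<eta> y x"
    using ex_barrier_without_max[OF pos \<open>0 < \<delta>\<close> \<epsilon>(1)] by blast
  have "W x \<le> m - \<epsilon>" for x
    using W \<open>0 < \<alpha>\<close> \<epsilon>(1) max[OF \<open>0 < \<alpha>\<close> \<epsilon>(1)] no_max near
    by (rule le_if_no_barrier_max_inequality)
  then have "m \<le> m - \<epsilon>" unfolding m_def by (intro cSup_least) auto
  then show False using \<epsilon>(1) by simp
qed

subsection \<open>Self-similar solutions\<close>

lemma (in jet) euler_identity:
  assumes "t \<le> 0" and homogeneous: "\<And>s. 0 < s \<Longrightarrow> u (s\<^sup>2 * t, s *\<^sub>R y) = s ^ m * u (t, y)"
  shows "a 0 1 y + 2 * t * a 1 0 0 = m * u (t, y)"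
proof -
  define \<gamma> where "\<gamma> s = (s\<^sup>2 * t, s *\<^sub>R y)" for s
  have \<gamma>_deriv: "(\<gamma> has_derivative (\<lambda>h. (2 * t * h, h *\<^sub>R y))) (at 1)"
    unfolding \<gamma>_def by (auto intro!: derivative_eq_intros)
  have "\<gamma> ` UNIV \<subseteq> {..0} \<times> UNIV" using assms(1) by (auto simp: \<gamma>_def mult_nonneg_nonpos)
  then have "(u has_derivative (\<lambda>(\<tau>, x). a 1 0 0 * \<tau> + a 0 1 x)) (at (\<gamma> 1) within \<gamma> ` UNIV)"
    using has_derivative_subset[OF has_derivative[OF assms(1)]] by (simp add: \<gamma>_def)
  from has_derivative_in_compose[OF \<gamma>_deriv this]
  have "((\<lambda>s. u (\<gamma> s)) has_derivative (*) (a 0 1 y + 2 * t * a 1 0 0)) (at 1)"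
    by (rule has_derivative_eq_rhs) (simp add: fun_eq_iff coeff_scaleR algebra_simps)
  then have chain_rule: "((\<lambda>s. u (\<gamma> s)) has_real_derivative a 0 1 y + 2 * t * a 1 0 0) (at 1)"
    by (simp only: has_field_derivative_def)
  have "\<forall>\<^sub>F s in nhds (1 :: real). s \<in> {0<..}" by (rule eventually_nhds_in_open) auto
  then have "\<forall>\<^sub>F s in nhds 1. u (\<gamma> s) = s ^ m * u (t, y)"
    by eventually_elim (simp add: \<gamma>_def homogeneous)
  from chain_rule[unfolded DERIV_cong_ev[OF refl this refl]]
  have "((\<lambda>s. s ^ m * u (t, y)) has_real_derivative a 0 1 y + 2 * t * a 1 0 0) (at 1)" .
  moreover have "((\<lambda>s. s ^ m * u (t, y)) has_real_derivative m * u (t, y)) (at 1)"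
    by (auto intro!: derivative_eq_intros)
  ultimately show ?thesis by (rule DERIV_unique)
qed

lemma (in jet_coefficients) space_quadratic_coeff_le:
  assumes "\<And>x. a 1 2 x \<le> c * (norm x)\<^sup>2 - e * (z \<bullet> x)\<^sup>2"
  obtains C where "0 \<le> C" "\<And>\<tau> x. 0 \<le> \<tau> \<Longrightarrow> \<tau> \<le> \<rho> \<Longrightarrow>
    space_coeff a \<tau> 2 x \<le> a 0 2 x + (\<tau> * c + C * \<tau>\<^sup>2) * (norm x)\<^sup>2 - \<tau> * e * (z \<bullet> x)\<^sup>2"
proof -
  obtain C where "0 \<le> C" and taylor: "\<And>\<tau> x. \<bar>\<tau>\<bar> \<le> \<rho> \<Longrightarrow>
      \<bar>space_coeff a \<tau> 2 x - (\<Sum>k<2. a k 2 x * \<tau> ^ k)\<bar> \<le> C * \<bar>\<tau>\<bar>\<^sup>2 * (norm x)\<^sup>2"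
    using space_coeff_taylor[of 2 2] by blast
  have "space_coeff a \<tau> 2 x \<le> a 0 2 x + (\<tau> * c + C * \<tau>\<^sup>2) * (norm x)\<^sup>2 - \<tau> * e * (z \<bullet> x)\<^sup>2"
    if "0 \<le> \<tau>" "\<tau> \<le> \<rho>" for \<tau> x
  proof -
    have "space_coeff a \<tau> 2 x \<le> a 0 2 x + \<tau> * a 1 2 x + C * \<tau>\<^sup>2 * (norm x)\<^sup>2"
      using taylor[of \<tau> x] that by (simp add: abs_le_iff numeral_2_eq_2 mult.commute)
    also have "\<tau> * a 1 2 x \<le> \<tau> * (c * (norm x)\<^sup>2 - e * (z \<bullet> x)\<^sup>2)"
      using that assms by (intro mult_left_mono) auto
    finally show ?thesis by (simp add: algebra_simps)
  qed
  with \<open>0 \<le> C\<close> show thesis by (rule that)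
qed

lemma (in jet) time_deriv_lower_bound:
  obtains D where "\<And>\<tau>. 0 \<le> \<tau> \<Longrightarrow> \<tau> \<le> \<rho> / 2 \<Longrightarrow> t + \<tau> \<le> 0 \<Longrightarrow>
    a 1 0 0 + 2 * a 2 0 0 * \<tau> \<le> time_deriv u (t + \<tau>, y) + D * \<tau>\<^sup>2"
proof -
  obtain D where taylor: "\<And>\<tau>. \<bar>\<tau>\<bar> \<le> \<rho> / 2 \<Longrightarrow> t + \<tau> \<le> 0 \<Longrightarrow>
      \<bar>time_deriv u (t + \<tau>, y) - (\<Sum>k<2. time_deriv_coeff a k 0 0 * \<tau> ^ k)\<bar> \<le> D * \<bar>\<tau>\<bar>\<^sup>2"
    using jet.center_taylor[OF jet_time_deriv, of 2] by blast
  have "a 1 0 0 + 2 * a 2 0 0 * \<tau> \<le> time_deriv u (t + \<tau>, y) + D * \<tau>\<^sup>2"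
    if "0 \<le> \<tau>" "\<tau> \<le> \<rho> / 2" "t + \<tau> \<le> 0" for \<tau>
    using taylor[of \<tau>] that by (simp add: abs_le_iff numeral_2_eq_2 time_deriv_coeff_def)
  then show thesis by (rule that)
qed

text \<open>
  The equation differentiated in time: \<open>2 * a 2 0 0\<close> is the second time derivative of \<open>u\<close> and
  \<open>a 1 2\<close> half the quadratic form of the Hessian of its time derivative. As \<open>F\<close> need not be
  differentiable, only a one-sided bound survives.
\<close>

lemma (in elliptic_operator) time_differentiated_equation:
  assumes "jet u t y \<rho> a A" "t < 0" and solves: "\<And>s. s < 0 \<Longrightarrow> solves_at F u s y"
    and nonneg: "0 \<le> c" "0 \<le> e"
    and form_le: "\<And>x. a 1 2 x \<le> c * (norm x)\<^sup>2 - e * (z \<bullet> x)\<^sup>2"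
  shows "a 2 0 0 \<le> Lam * CARD('n) * c - lam * e * (norm z)\<^sup>2"
proof -
  interpret jet u t y \<rho> a A by fact
  obtain C where "0 \<le> C" and form_bound: "\<And>\<tau> x. 0 \<le> \<tau> \<Longrightarrow> \<tau> \<le> \<rho> \<Longrightarrow>
      space_coeff a \<tau> 2 x \<le> a 0 2 x + (\<tau> * c + C * \<tau>\<^sup>2) * (norm x)\<^sup>2 - \<tau> * e * (z \<bullet> x)\<^sup>2"
    using space_quadratic_coeff_le[OF form_le] by blast
  obtain D where lower: "\<And>\<tau>. 0 \<le> \<tau> \<Longrightarrow> \<tau> \<le> \<rho> / 2 \<Longrightarrow> t + \<tau> \<le> 0 \<Longrightarrow>
      a 1 0 0 + 2 * a 2 0 0 * \<tau> \<le> time_deriv u (t + \<tau>, y) + D * \<tau>\<^sup>2"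
    using time_deriv_lower_bound by blast
  define K where "K = 2 * Lam * CARD('n)"
  have "\<forall>\<^sub>F \<tau> in at_right 0. 0 < \<tau> \<and> \<tau> < min (\<rho> / 2) (- t)"
    using radius_pos assms(2)
    by (auto simp: eventually_at_right_field intro!: exI[of _ "min (\<rho> / 2) (- t)"])
  then have "\<forall>\<^sub>F \<tau> in at_right 0.
      2 * a 2 0 0 - (K * c - 2 * lam * e * (norm z)\<^sup>2) \<le> (K * C + D) * \<bar>\<tau>\<bar>"
  proof eventually_elim
    case (elim \<tau>)
    then have \<tau>: "0 < \<tau>" "\<tau> \<le> \<rho> / 2" "\<tau> \<le> \<rho>" "\<bar>\<tau>\<bar> \<le> \<rho>" "t + \<tau> < 0" "t + \<tau> \<le> 0" by auto
    note shift = solves_at_time_shift[OF solves[OF \<tau>(5)] \<tau>(4,6)]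
    have "F (form_hessian (space_coeff a \<tau> 2))
        \<le> F (form_hessian (a 0 2)) + K * (\<tau> * c + C * \<tau>\<^sup>2) - 2 * lam * (\<tau> * e) * (norm z)\<^sup>2"
      unfolding K_def using \<tau>(1,3) \<open>0 \<le> C\<close> nonneg
      by (intro F_upper_bound quadratic_coeff shift(1) form_bound) auto
    moreover have "a 1 0 0 = F (form_hessian (a 0 2))"
      using solves_at_iff solves[OF assms(2)] assms(2) by simp
    ultimately have "time_deriv u (t + \<tau>, y)
        \<le> a 1 0 0 + K * (\<tau> * c + C * \<tau>\<^sup>2) - 2 * lam * (\<tau> * e) * (norm z)\<^sup>2"
      by (simp only: shift(2))
    with lower[of \<tau>] \<tau>
    have "(2 * a 2 0 0 - (K * c - 2 * lam * e * (norm z)\<^sup>2)) * \<tau> \<le> (K * C + D) * \<bar>\<tau>\<bar> * \<tau>"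
      by (simp add: algebra_simps power2_eq_square)
    then show ?case by (rule mult_right_le_imp_le[OF _ \<tau>(1)])
  qed
  from nonpos_if_eventually_le_abs[OF _ at_le this] show ?thesis by (simp add: K_def)
qed

lemma bounded_if_parabolic_invariant:
  fixes w :: "real \<times> (real^'n) \<Rightarrow> real"
  assumes cont: "continuous_on ({..0} \<times> UNIV - {(0, 0)}) w"
    and invariant: "\<And>t y s. t \<le> 0 \<Longrightarrow> (t, y) \<noteq> (0, 0) \<Longrightarrow> 0 < s \<Longrightarrow>
      w (s\<^sup>2 * t, s *\<^sub>R y) = w (t, y)"
  shows "bounded (w ` ({..0} \<times> UNIV - {(0, 0)}))"
proof -
  define K :: "(real \<times> (real^'n)) set"
    where "K = ({-1..0} \<times> cball 0 1) \<inter> {p. (norm (snd p))\<^sup>2 - fst p = 1}"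
  have "compact K"
    unfolding K_def
    by (intro compact_Int_closed compact_Times closed_Collect_eq continuous_intros) auto
  moreover have "K \<subseteq> {..0} \<times> UNIV - {(0, 0)}" by (auto simp: K_def)
  ultimately have "bounded (w ` K)"
    using continuous_on_subset[OF cont] compact_continuous_image compact_imp_bounded by blast
  moreover have "w ` ({..0} \<times> UNIV - {(0, 0)}) \<subseteq> w ` K"
  proof (intro image_subsetI)
    fix p :: "real \<times> (real^'n)" assume "p \<in> {..0} \<times> UNIV - {(0, 0)}"
    then obtain t y where p_eq: "p = (t, y)" and past: "t \<le> 0" "(t, y) \<noteq> (0, 0)" by (cases p) auto
    define r where "r = (norm y)\<^sup>2 - t"
    define s where "s = 1 / sqrt r"
    have "0 < r" using past by (cases "y = 0") (auto simp: r_def intro: le_less_trans)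
    then have "0 < s" "s\<^sup>2 * r = 1" by (auto simp: s_def power_divide)
    then have normalized: "s\<^sup>2 * (norm y)\<^sup>2 - s\<^sup>2 * t = 1" by (simp add: r_def right_diff_distrib)
    moreover have nonneg: "0 \<le> s\<^sup>2 * (norm y)\<^sup>2" "s\<^sup>2 * t \<le> 0"
      using past(1) by (auto simp: mult_nonneg_nonpos)
    ultimately have bounds: "- 1 \<le> s\<^sup>2 * t" "(s * norm y)\<^sup>2 \<le> 1"
      unfolding power_mult_distrib by linarith+
    then have "s * norm y \<le> 1" using abs_square_le_1[of "s * norm y"] \<open>0 < s\<close> by simp
    then have "(s\<^sup>2 * t, s *\<^sub>R y) \<in> {-1..0} \<times> cball 0 1"
      using bounds(1) nonneg(2) \<open>0 < s\<close> by simp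
    then have "(s\<^sup>2 * t, s *\<^sub>R y) \<in> K"
      using normalized \<open>0 < s\<close> by (simp add: K_def power_mult_distrib)
    moreover have "w (t, y) = w (s\<^sup>2 * t, s *\<^sub>R y)" using invariant[OF past \<open>0 < s\<close>] by simp
    ultimately show "w p \<in> w ` K" unfolding p_eq by (rule rev_image_eqI)
  qed
  ultimately show ?thesis by (rule bounded_subset)
qed

locale self_similar_solution = elliptic_operator F lam Lam
  for F :: "real^'n^'n \<Rightarrow> real" and lam Lam +
  fixes U :: "real \<times> (real^'n) \<Rightarrow> real"
  assumes homogeneous: "parabolic_homogeneous_on ({..0} \<times> UNIV) U"
    and solves: "\<And>t y. t \<le> 0 \<Longrightarrow> (t, y) \<noteq> (0, 0) \<Longrightarrow> solves_at F U t y"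
begin

lemma scaling: "t \<le> 0 \<Longrightarrow> 0 < s \<Longrightarrow> U (s\<^sup>2 * t, s *\<^sub>R y) = s\<^sup>2 * U (t, y)"
  using homogeneous by (auto simp: parabolic_homogeneous_on_def mult_nonneg_nonpos)

lemma obtain_jet:
  assumes "t \<le> 0" "(t, y) \<noteq> (0, 0)"
  obtains \<rho> a A where "jet U t y \<rho> a A"
  using solves[OF assms] unfolding solves_at_def by blast

lemma time_deriv_scaling:
  assumes "t \<le> 0" "(t, y) \<noteq> (0, 0)" "0 < s"
  shows "time_deriv U (s\<^sup>2 * t, s *\<^sub>R y) = time_deriv U (t, y)"
proof -
  have contraction: "time_deriv U (s\<^sup>2 * t, s *\<^sub>R y) = time_deriv U (t, y)"
    if past: "t \<le> 0" "(t, y) \<noteq> (0, 0)" and s: "0 < s" "s \<le> 1" for t s and y :: "real^'n"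
  proof -
    have scaled_past: "s\<^sup>2 * t \<le> 0" using past(1) by (simp add: mult_nonneg_nonpos)
    then obtain \<rho> a A where jet: "jet U (s\<^sup>2 * t) (s *\<^sub>R y) \<rho> a A"
      using obtain_jet[of "s\<^sup>2 * t" "s *\<^sub>R y"] past(2) s(1) by auto
    have "\<forall>\<^sub>F p in nhds (t, y). fst p \<le> 0 \<longrightarrow> U p = parabolic_rescale s U p"
      using scaling s(1) by (auto simp: parabolic_rescale_def intro!: always_eventually)
    from jet.eventually_cong[OF jet_rescale[OF jet s] this]
    obtain r where "jet U t y r (rescale_coeff s a) (rescale_majorant s A)" by blast
    from jet.time_deriv_center[OF this past(1)] have "time_deriv U (t, y) = a 1 0 0"
      using s(1) by (simp add: rescale_coeff_def power2_eq_square)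
    then show ?thesis using jet.time_deriv_center[OF jet scaled_past] by simp
  qed
  show ?thesis
  proof (cases "s \<le> 1")
    case False
    then show ?thesis
      using contraction[of "s\<^sup>2 * t" "s *\<^sub>R y" "1 / s"] assms
      by (simp add: power_divide mult_nonneg_nonpos)
  qed (use contraction assms in simp)
qed

lemma continuous_on_time_deriv: "continuous_on ({..0} \<times> UNIV - {(0, 0)}) (time_deriv U)"
  unfolding continuous_on_eq_continuous_within
proof (intro ballI)
  fix p :: "real \<times> (real^'n)" assume p: "p \<in> {..0} \<times> UNIV - {(0, 0)}"
  then obtain t y where p_eq: "p = (t, y)" and past: "t \<le> 0" "(t, y) \<noteq> (0, 0)" by (cases p) auto
  obtain \<rho> a A where "jet U t y \<rho> a A" using obtain_jet[OF past] .
  from jet.has_derivative[OF jet.jet_time_deriv[OF this] past(1)]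
  show "continuous (at p within {..0} \<times> UNIV - {(0, 0)}) (time_deriv U)"
    unfolding p_eq by (intro continuous_within_subset[OF has_derivative_continuous]) auto
qed

lemma time_deriv_coeff_at_barrier_max:
  assumes "jet U (-1) y \<rho> a A"
    and max: "\<forall>\<^sub>F x in nhds y.
      time_deriv U (-1, x) + barrier \<alpha> \<epsilon> \<eta> y\<^sub>0 x \<le> time_deriv U (-1, y) + barrier \<alpha> \<epsilon> \<eta> y\<^sub>0 y"
  defines "z \<equiv> y - y\<^sub>0" and "b \<equiv> \<epsilon> * exp (- \<alpha> * (norm (y - y\<^sub>0))\<^sup>2)"
  shows "a 1 1 x = 2 * \<alpha> * b * (z \<bullet> x) + 2 * \<eta> * (y \<bullet> x)"
    and "a 1 2 x \<le> (\<alpha> * b + \<eta>) * (norm x)\<^sup>2 - 2 * \<alpha>\<^sup>2 * b * (z \<bullet> x)\<^sup>2"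
proof -
  obtain g where g: "\<And>s. ((\<lambda>s. barrier \<alpha> \<epsilon> \<eta> y\<^sub>0 (y + s *\<^sub>R x)) has_real_derivative g s) (at s)"
    "g 0 = - (2 * \<alpha> * b * (z \<bullet> x) + 2 * \<eta> * (y \<bullet> x))"
    "(g has_real_derivative 4 * \<alpha>\<^sup>2 * b * (z \<bullet> x)\<^sup>2 - 2 * (\<alpha> * b + \<eta>) * (norm x)\<^sup>2) (at 0)"
    unfolding b_def z_def using barrier_line_derivatives[of \<alpha> \<epsilon> \<eta> y\<^sub>0 y x] by blast
  from jet.space_local_max[OF jet.jet_time_deriv[OF assms(1)] _ g(1,3) max] g(2)
  show "a 1 1 x = 2 * \<alpha> * b * (z \<bullet> x) + 2 * \<eta> * (y \<bullet> x)"
    and "a 1 2 x \<le> (\<alpha> * b + \<eta>) * (norm x)\<^sup>2 - 2 * \<alpha>\<^sup>2 * b * (z \<bullet> x)\<^sup>2"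
    by (simp_all add: time_deriv_coeff_def algebra_simps)
qed

lemma barrier_max_inequality_time_deriv:
  assumes pos: "0 < \<alpha>" "0 < \<epsilon>" "0 < \<eta>"
    and max: "\<forall>\<^sub>F x in nhds y.
      time_deriv U (-1, x) + barrier \<alpha> \<epsilon> \<eta> y\<^sub>0 x \<le> time_deriv U (-1, y) + barrier \<alpha> \<epsilon> \<eta> y\<^sub>0 y"
  shows "barrier_max_inequality lam (Lam * CARD('n)) \<alpha> \<epsilon> \<eta> y\<^sub>0 y"
proof -
  define z b where "z = y - y\<^sub>0" and "b = \<epsilon> * exp (- \<alpha> * (norm z)\<^sup>2)"
  have "0 < b" using pos by (simp add: b_def)
  obtain \<rho> a A where jet: "jet U (-1) y \<rho> a A" using obtain_jet[of "-1" y] by auto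
  note at_max = time_deriv_coeff_at_barrier_max[OF jet max, folded z_def, folded b_def]
  have "a 2 0 0 \<le> Lam * CARD('n) * (\<alpha> * b + \<eta>) - lam * (2 * \<alpha>\<^sup>2 * b) * (norm z)\<^sup>2"
    by (rule time_differentiated_equation[OF jet _ solves]) (use at_max(2) pos \<open>0 < b\<close> in auto)
  moreover have "a 1 1 y = 4 * a 2 0 0"
    using jet.euler_identity[OF jet.jet_time_deriv[OF jet], of 0] time_deriv_scaling[of "-1" y]
    by (simp add: time_deriv_coeff_def numeral_2_eq_2)
  ultimately show ?thesis
    using at_max(1)[of y]
    unfolding barrier_max_inequality_def Let_def z_def[symmetric] b_def[symmetric]
      power2_norm_eq_inner[of y]
    by (simp add: algebra_simps)
qed

lemma time_deriv_constant: "\<exists>c. \<forall>t<0. \<forall>y. time_deriv U (t, y) = c"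
proof -
  have "bounded (time_deriv U ` ({..0} \<times> UNIV - {(0, 0)}))"
    by (rule bounded_if_parabolic_invariant[OF continuous_on_time_deriv time_deriv_scaling])
  then have bounded: "bounded (range (\<lambda>y. time_deriv U (-1, y)))"
    by (rule bounded_subset) auto
  have cont: "continuous_on UNIV (\<lambda>y. time_deriv U (-1, y))"
    by (rule continuous_on_compose2[OF continuous_on_time_deriv]) (auto intro!: continuous_intros)
  have "time_deriv U (-1, y) = Sup (range (\<lambda>y. time_deriv U (-1, y)))" for y
    by (rule drift_liouville[OF cont bounded lam_pos _ barrier_max_inequality_time_deriv])
       (use lam_pos lam_le_Lam in auto)
  moreover have "time_deriv U (t, y) = time_deriv U (-1, (1 / sqrt (- t)) *\<^sub>R y)" if "t < 0" for t y
    using time_deriv_scaling[of "-1" "(1 / sqrt (- t)) *\<^sub>R y" "sqrt (- t)"] that by simp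
  ultimately show ?thesis by metis
qed

lemma has_time_deriv:
  assumes "t \<le> 0" "(t, y) \<noteq> (0, 0)"
  shows "((\<lambda>s. U (s, y)) has_real_derivative time_deriv U (t, y)) (at t within {..0})"
proof -
  obtain \<rho> a A where "jet U t y \<rho> a A" using obtain_jet[OF assms] .
  then interpret jet U t y \<rho> a A .
  show ?thesis
    using has_time_derivative[of 0 0] radius_pos assms(1) time_deriv_center[OF assms(1)]
    by (simp add: powser_zero diffs_def time_coeff_0)
qed

lemma terminal_value_eq:
  assumes deriv_constant: "\<And>t y. t < 0 \<Longrightarrow> time_deriv U (t, y) = c" and "y \<noteq> 0"
  shows "U (0, y) = U (-1, y) + c"
proof -
  have "U (0, y) - c * 0 = U (-1, y) - c * (-1)"
  proof (rule DERIV_isconst_end[of "-1" 0 "\<lambda>s. U (s, y) - c * s"])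
    have "continuous_on {..0} (\<lambda>s. U (s, y))"
      by (rule DERIV_continuous_on[OF has_time_deriv]) (use assms(2) in auto)
    then show "continuous_on {-1..0} (\<lambda>s. U (s, y) - c * s)"
      by (intro continuous_intros) (auto intro: continuous_on_subset)
    fix t :: real assume "- 1 < t" "t < 0"
    moreover from this have "at t within {..0} = at t" by (intro at_within_interior) simp
    ultimately have "((\<lambda>s. U (s, y)) has_real_derivative c) (at t)"
      using has_time_deriv[of t y] deriv_constant[of t y] by simp
    then show "((\<lambda>s. U (s, y) - c * s) has_real_derivative 0) (at t)"
      by (auto intro!: derivative_eq_intros)
  qed simp
  then show ?thesis by simp
qed

theorem quadratic_form_terminal_value: "quadratic_form (\<lambda>x. U (0, x))"
proof -
  obtain c where deriv_constant: "\<And>t y. t < 0 \<Longrightarrow> time_deriv U (t, y) = c"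
    using time_deriv_constant by metis
  obtain \<rho> a A where "jet U (-1) 0 \<rho> a A" using obtain_jet[of "-1" 0] by auto
  then interpret jet U "-1" 0 \<rho> a A .
  have "U (0, x) = a 0 2 x" for x
  proof (cases "x = 0")
    case True
    then show ?thesis using scaling[of 0 2 0] coeff_at_0[of 2 0] by simp
  next
    case False
    define g where "g n = (if n = 0 then - c else if n = 2 then U (0, x) else 0)" for n :: nat
    have "(\<lambda>n. a 0 n x) = g"
    proof (rule powser_unique[where F = "at_right 0" and v = "\<lambda>s. s\<^sup>2 * U (0, x) - c"])
      have "\<forall>\<^sub>F s in at_right 0. (\<lambda>n. a 0 n x * s ^ n) sums U (-1, s *\<^sub>R x)"
        using eventually_nhds_imp_at_right[OF eventually_space_expansion[of 0 x]] radius_pos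
        by (simp add: space_coeff_time_0)
      with eventually_at_right_less
      show "\<forall>\<^sub>F s in at_right 0. (\<lambda>n. a 0 n x * s ^ n) sums (s\<^sup>2 * U (0, x) - c)"
      proof eventually_elim
        case (elim s)
        have "U (-1, s *\<^sub>R x) = s\<^sup>2 * U (0, x) - c"
          using terminal_value_eq[OF deriv_constant, of "s *\<^sub>R x"] scaling[of 0 s x] elim False
          by simp
        then show ?case using elim by simp
      qed
      have "(\<lambda>n. g n * s ^ n) sums (\<Sum>n\<in>{0, 2}. g n * s ^ n)" for s
        by (rule sums_finite) (auto simp: g_def)
      then show "\<forall>\<^sub>F s in at_right 0. (\<lambda>n. g n * s ^ n) sums (s\<^sup>2 * U (0, x) - c)"
        by (intro always_eventually) (simp add: g_def mult.commute)
    qed (auto intro: at_le)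
    then have "a 0 2 x = g 2" by (rule fun_cong)
    then show ?thesis by (simp add: g_def)
  qed
  then show ?thesis using quadratic_coeff[of 0] by simp
qed

end

lemma C2_on_quadratic_form:
  assumes "quadratic_form q" and agree: "\<And>x. x \<in> S \<Longrightarrow> f x = q x" and "open S"
  shows "C2_on S f"
proof -
  have "C12_test (\<lambda>(s, x). q x) (\<lambda>(s, x). 0) (\<lambda>i j _. form_hessian q $ i $ j)"
    using C12_test_paraboloid[OF linear_zero assms(1), of "(0, 0)" 0 0 0]
    by (simp add: paraboloid_def)
  then obtain g where g: "\<And>i. continuous_on UNIV (g i)"
    "\<And>(t :: real) x i. ((\<lambda>s. q (x + s *\<^sub>R axis i 1)) has_real_derivative g i (t, x)) (at 0)"
    "\<And>(t :: real) x i j. ((\<lambda>s. g i (t, x + s *\<^sub>R axis j 1)) has_real_derivative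
      form_hessian q $ i $ j) (at 0)"
    unfolding C12_test_def prod.case by blast
  show ?thesis
    unfolding C2_on_def
  proof (intro exI conjI allI ballI)
    show "continuous_on S f"
      by (rule continuous_on_eq[OF continuous_on_quadratic_form[OF assms(1)]]) (simp add: agree)
    show "continuous_on S (\<lambda>x. g i (0, x))" for i
      by (rule continuous_on_compose2[OF g(1)]) (auto intro!: continuous_intros)
    show "continuous_on S (\<lambda>x. form_hessian q $ i $ j)" for i j by simp
    fix x i j assume x: "x \<in> S"
    show "((\<lambda>s. f (x + s *\<^sub>R axis i 1)) has_real_derivative g i (0, x)) (at 0)"
    proof (rule has_field_derivative_transform_within_open[OF g(2)])
      show "open ((\<lambda>s. x + s *\<^sub>R axis i 1) -` S)"
        using assms(3) by (intro open_vimage continuous_intros)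
    qed (use x agree in auto)
    show "((\<lambda>s. g i (0, x + s *\<^sub>R axis j 1)) has_real_derivative form_hessian q $ i $ j) (at 0)"
      by (rule g(3))
  qed
qed

lemma (in elliptic_operator) analytic_viscosity_solution_solves_at:
  assumes "viscosity_solution F Q1 u" "(t, y) \<in> Q1" "open V" "(t, y) \<in> V" "real_analytic_on g V"
    and agree: "\<forall>q\<in>V \<inter> Q1. u q = g q"
  shows "solves_at F u t y"
proof -
  obtain \<rho> a A where jet: "jet g t y \<rho> a A"
    using real_analytic_imp_jet assms(4,5) unfolding real_analytic_on_def by blast
  have "open (V \<inter> ({-1<..} \<times> ball 0 1))" "(t, y) \<in> V \<inter> ({-1<..} \<times> ball 0 1)"
    using assms(2-4) by (auto intro!: open_Times simp: Q1_iff)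
  from eventually_nhds_in_open[OF this]
  have "\<forall>\<^sub>F p in nhds (t, y). fst p \<le> 0 \<longrightarrow> u p = g p"
    by eventually_elim (use agree in \<open>auto simp: Q1_iff\<close>)
  then obtain r where "jet u t y r a A" using jet.eventually_cong[OF jet] by blast
  moreover have "Q1 \<subseteq> {..0} \<times> UNIV" by (auto simp: Q1_def)
  ultimately show ?thesis by (rule viscosity_solution_solves_at[OF assms(1,2), rotated])
qed

theorem theorem1p3:
  fixes F :: "real^'n^'n \<Rightarrow> real" and lam Lam :: real
  assumes "0 < lam" and "lam \<le> Lam" and "uniformly_elliptic lam Lam F"
  shows "\<not> (\<exists>u :: real \<times> (real^'n) \<Rightarrow> real.
     continuous_on Q1 u \<and>
     viscosity_solution F Q1 u \<and>
     (\<forall>p\<in>Q1 - {(0, 0)}. \<exists>U g. open U \<and> p \<in> U \<and> real_analytic_on g U \<and>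
        (\<forall>q\<in>U \<inter> Q1. u q = g q)) \<and>
     (\<forall>a>0. \<forall>x. x \<in> ball 0 1 \<and> a *\<^sub>R x \<in> ball 0 1 \<longrightarrow> u (0, a *\<^sub>R x) = a ^ 2 * u (0, x)) \<and>
     \<not> (\<exists>r>0. C2_on (ball 0 r) (\<lambda>x. u (0, x))))"
proof (rule notI, elim exE conjE)
  fix u :: "real \<times> (real^'n) \<Rightarrow> real"
  assume cont: "continuous_on Q1 u" and viscosity: "viscosity_solution F Q1 u"
    and analytic: "\<forall>p\<in>Q1 - {(0, 0)}. \<exists>U g. open U \<and> p \<in> U \<and> real_analytic_on g U \<and>
      (\<forall>q\<in>U \<inter> Q1. u q = g q)"
    and terminal: "\<forall>a>0. \<forall>x. x \<in> ball 0 1 \<and> a *\<^sub>R x \<in> ball 0 1 \<longrightarrow>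
      u (0, a *\<^sub>R x) = a ^ 2 * u (0, x)"
    and not_C2: "\<not> (\<exists>r>0. C2_on (ball 0 r) (\<lambda>x. u (0, x)))"
  interpret elliptic_operator F lam Lam using assms by unfold_locales
  have solves: "solves_at F u t y" if "(t, y) \<in> Q1 - {(0, 0)}" for t y
    using bspec[OF analytic that]
      analytic_viscosity_solution_solves_at[OF viscosity DiffD1[OF that]]
    by (elim exE conjE)
  have homogeneous_Q1: "parabolic_homogeneous_on Q1 u"
    by (rule solution_parabolic_homogeneous[OF cont solves]) (use terminal in auto)
  interpret self_similar_solution F lam Lam "parabolic_extension u"
    by unfold_locales
      (intro parabolic_extension_homogeneous parabolic_extension_solves_at homogeneous_Q1 solves)+
  have "C2_on (ball 0 1) (\<lambda>x. u (0, x))"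
    by (rule C2_on_quadratic_form[OF quadratic_form_terminal_value])
       (auto simp: parabolic_extension_eq[OF homogeneous_Q1] Q1_iff)
  then show False using not_C2 zero_less_one by blast
qed

end
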